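(* For $M\in\mathbb{N}$ let $\mathrm{T}_M=\left\{\sum_{m=-M}^{M}a_m e^{2\pi i m x}: a_m\in\mathbb{C}\right\}\subseteq L^2(0,1)$. For every $0<\delta<1$ and $0<\epsilon<1-\delta$ there exists a constant $c>0$, depending only on $\delta$ and $\epsilon$, such that the following holds. For every uniformly $\delta$-dense sequence $\{\Omega_N\}_{N\in\mathbb{N}}$ with bandwidths $\{K_N\}_{N\in\mathbb{N}}$, and all $M,N\in\mathbb{N}$ with $$M\le c\,K_N,$$ the weighted least-squares reconstruction from $\mathrm{T}_M$ using the samples at $\Omega_N$ is stable and quasi-optimal with constant $\frac{1+\delta}{1-\epsilon-\delta}$.
   Context: $\mathbb{N}=\{1,2,\dots\}$; $\mathrm{H}=L^2(0,1)$ (complex-valued functions) with usual norm $\|\cdot\|$; $\hat f(\omega)=\int_0^1 f(x)e^{-2\pi i\omega x}\,dx$ for $f\in\mathrm{H}$, $\omega\in\mathbb{R}$. Sampling points: $\{\Omega_N\}_{N\in\mathbb{N}}$ with $\Omega_N=\{\omega_{n,N}\}_{n=1}^N\subseteq\mathbb{R}$, $\omega_{1,N}<\dots<\omega_{N,N}$. The sequence is uniformly $\delta$-dense ($0<\delta<1$) with bandwidths $\{K_N\}_{N\in\mathbb{N}}\subseteq[0,\infty)$ if: (i) $K_N\to\infty$ as $N\to\infty$ and $\Omega_N\subseteq[-K_N,K_N]$ for each $N$; (ii) for each $N$, $\max_{n=0,\dots,N}\{\omega_{n+1,N}-\omega_{n,N}\}\le\delta$, where $\omega_{0,N}=\omega_{N,N}-2K_N$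 and $\omega_{N+1,N}=\omega_{1,N}+2K_N$. Weights: $\mu_{n,N}=\frac12(\omega_{n+1,N}-\omega_{n-1,N})$, $n=1,\dots,N$. Weighted least-squares reconstruction from a finite-dimensional subspace $\mathrm{T}\subseteq\mathrm{H}$ using the samples at $\Omega_N$: for $f\in\mathrm{H}$, $$f_{N,\mathrm{T}}=\underset{g\in\mathrm{T}}{\operatorname{argmin}}\sum_{n=1}^N\mu_{n,N}\left|\hat f(\omega_{n,N})-\hat g(\omega_{n,N})\right|^2.$$ It is called stable and quasi-optimal with constant $C$ if for every $f\in\mathrm{H}$ the minimizer $f_{N,\mathrm{T}}$ exists and is unique, and $$\|f-f_{N,\mathrm{T}}\|\le C\inf_{g\in\mathrm{T}}\|f-g\|,\qquad\|f_{N,\mathrm{T}}\|\le C\|f\|\qquad\forall f\in\mathrm{H}.$$ *)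

theory Defs
  imports "HOL-Analysis.Analysis"
begin

text \<open>
  Elements of \<open>H = L\<^sup>2(0,1)\<close> are represented by functions on the real line, of which only the
  values on the open unit interval matter. Equality in \<open>H\<close> is equality almost everywhere there.
\<close>

abbreviation unit_measure :: "real measure" where
  "unit_measure \<equiv> lebesgue_on {0<..<1}"

definition L2_unit :: "(real \<Rightarrow> complex) set" where
  "L2_unit = {f. f \<in> borel_measurable unit_measure \<and>
                 integrable unit_measure (\<lambda>x. (cmod (f x))\<^sup>2)}"

definition L2_norm :: "(real \<Rightarrow> complex) \<Rightarrow> real" where
  "L2_norm f = sqrt (LINT x|unit_measure. (cmod (f x))\<^sup>2)"

definition fourier :: "(real \<Rightarrow> complex) \<Rightarrow> real \<Rightarrow> complex" where
  "fourier f w = (LINT x|unit_measure. f x * exp (- 2 * of_real pi * \<i> * of_real w * of_real x))"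

text \<open>
  In the following, \<open>w n\<close> for \<open>n = 1, \<dots>, N\<close> are the points of a single sampling set of bandwidth
  \<open>K\<close>; other values of \<open>w\<close> are irrelevant. \<open>ext_point N K w\<close> adds the wrap-around points of
  indices \<open>0\<close> and \<open>N + 1\<close>.
\<close>

definition ext_point :: "nat \<Rightarrow> real \<Rightarrow> (nat \<Rightarrow> real) \<Rightarrow> nat \<Rightarrow> real" where
  "ext_point N K w n =
     (if n = 0 then w N - 2 * K else if n = N + 1 then w 1 + 2 * K else w n)"

definition weight :: "nat \<Rightarrow> real \<Rightarrow> (nat \<Rightarrow> real) \<Rightarrow> nat \<Rightarrow> real" where
  "weight N K w n = (ext_point N K w (n + 1) - ext_point N K w (n - 1)) / 2"

text \<open>
  A sequence of sampling sets is given by \<open>\<Omega> N n\<close> with \<open>N \<ge> 1\<close> and \<open>1 \<le> n \<le> N\<close>;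
  \<open>\<Omega> 0\<close> and \<open>K 0\<close> are irrelevant.
\<close>

definition uniformly_dense :: "real \<Rightarrow> (nat \<Rightarrow> nat \<Rightarrow> real) \<Rightarrow> (nat \<Rightarrow> real) \<Rightarrow> bool" where
  "uniformly_dense \<delta> \<Omega> K \<longleftrightarrow>
     0 < \<delta> \<and> \<delta> < 1 \<and>
     filterlim K at_top sequentially \<and>
     (\<forall>N\<ge>1. K N \<ge> 0 \<and>
             strict_mono_on {1..N} (\<Omega> N) \<and>
             \<Omega> N ` {1..N} \<subseteq> {- K N..K N} \<and>
             (MAX n\<in>{0..N}. ext_point N (K N) (\<Omega> N) (n + 1) - ext_point N (K N) (\<Omega> N) n) \<le> \<delta>)"

definition wls_functional ::
  "nat \<Rightarrow> real \<Rightarrow> (nat \<Rightarrow> real) \<Rightarrow> (real \<Rightarrow> complex) \<Rightarrow> (real \<Rightarrow> complex) \<Rightarrow> real" where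
  "wls_functional N K w f g =
     (\<Sum>n=1..N. weight N K w n * (cmod (fourier f (w n) - fourier g (w n)))\<^sup>2)"

definition wls_reconstruction ::
  "nat \<Rightarrow> real \<Rightarrow> (nat \<Rightarrow> real) \<Rightarrow> (real \<Rightarrow> complex) set \<Rightarrow>
   (real \<Rightarrow> complex) \<Rightarrow> (real \<Rightarrow> complex) \<Rightarrow> bool" where
  "wls_reconstruction N K w T f g \<longleftrightarrow> is_arg_min (wls_functional N K w f) (\<lambda>h. h \<in> T) g"

definition stable_quasi_optimal ::
  "nat \<Rightarrow> real \<Rightarrow> (nat \<Rightarrow> real) \<Rightarrow> (real \<Rightarrow> complex) set \<Rightarrow> real \<Rightarrow> bool" where
  "stable_quasi_optimal N K w T C \<longleftrightarrow>
     (\<forall>f\<in>L2_unit.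
        (\<exists>g. wls_reconstruction N K w T f g) \<and>
        (\<forall>g h. wls_reconstruction N K w T f g \<longrightarrow> wls_reconstruction N K w T f h \<longrightarrow>
               (AE x in unit_measure. g x = h x)) \<and>
        (\<forall>g. wls_reconstruction N K w T f g \<longrightarrow>
               L2_norm (\<lambda>x. f x - g x) \<le> C * (INF h\<in>T. L2_norm (\<lambda>x. f x - h x)) \<and>
               L2_norm g \<le> C * L2_norm f))"

definition trig_poly :: "nat \<Rightarrow> (real \<Rightarrow> complex) set" where
  "trig_poly M =
     {(\<lambda>x. \<Sum>m=- int M..int M. a m * exp (2 * of_real pi * \<i> * of_int m * of_real x)) | a. True}"

end

theory Submission
  imports Defs "HOL-Probability.Sinc_Integral" "HOL-Probability.Characteristic_Functions"
    "HOL-Real_Asymp.Real_Asymp"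
begin

text \<open>
  Surround each sampling point by the cell bounded by the midpoints to its two neighbours; the weight
  is the length of the cell. After centring the support of \<open>f\<close> at the origin its transform has a
  derivative of norm at most \<open>pi\<close> times that of \<open>f\<close>, so Wirtinger's inequality on the half cells, of
  length at most \<open>\<delta> / 2\<close>, bounds the distance between the transform and its step-function interpolant
  by \<open>\<delta>\<close> times the norm of \<open>f\<close>. The sampled norm is therefore at most \<open>1 + \<delta>\<close> times the norm of \<open>f\<close>,
  and on \<open>T\<^sub>M\<close> it is at least \<open>1 - \<epsilon> - \<delta>\<close> times the norm, because all but a fraction \<open>\<epsilon>\<close> of the
  energy of a trigonometric polynomial of degree \<open>M\<close> lies in a frequency band of width proportional
  to \<open>M\<close>. Hence the reconstruction is a projection of norm at most \<open>C = (1 + \<delta>) / (1 - \<epsilon> - \<delta>)\<close>,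
  and the complementary projection has the same norm bound, so that the constant is \<open>C\<close> and not \<open>1 + C\<close>.
\<close>

section \<open>The Fourier transform on the unit interval\<close>

definition character :: "real \<Rightarrow> real \<Rightarrow> complex" where
  "character s x = cis (2 * pi * s * x)"

lemma norm_character [simp]: "cmod (character s x) = 1"
  by (simp add: character_def)

lemma cnj_character: "cnj (character s x) = character (- s) x"
  by (simp add: character_def cis_cnj)

lemma character_mult: "character s x * character t x = character (s + t) x"
  by (simp add: character_def cis_mult algebra_simps)

lemma continuous_on_character [continuous_intros]: "continuous_on A (character s)"
  unfolding character_def by (intro continuous_intros)

lemma fourier_alt: "fourier f w = (LINT x|unit_measure. f x * cnj (character w x))"
  unfolding fourier_def character_def cis_cnj
  by (rule Bochner_Integration.integral_cong) (auto simp: cis_conv_exp mult_ac)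

lemma trig_poly_alt: "trig_poly M = {(\<lambda>x. \<Sum>m=- int M..int M. a m * character (of_int m) x) | a. True}"
  unfolding trig_poly_def character_def by (simp add: cis_conv_exp mult_ac)

section \<open>Square-integrable functions on the unit interval\<close>

lemma borel_measurable_unit_continuous:
  fixes g :: "real \<Rightarrow> 'a::euclidean_space"
  assumes "continuous_on UNIV g"
  shows "g \<in> borel_measurable unit_measure"
  using assms by (intro continuous_imp_measurable_on_sets_lebesgue) (auto intro: continuous_on_subset)

lemma borel_measurable_unit_character [measurable]: "character s \<in> borel_measurable unit_measure"
  by (intro borel_measurable_unit_continuous continuous_intros)

lemma measure_unit_measure [simp]: "measure unit_measure {0<..<1} = 1"
  by (simp add: measure_restrict_space)

lemma integrable_unit_const [simp]: "integrable unit_measure (\<lambda>x. c::'a::{banach, second_countable_topology})"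
  using finite_measure_lebesgue_on[of "{0<..<1::real}"]
  by (auto intro!: finite_measure.integrable_const)

lemma L2_unit_measurable [measurable_dest]: "f \<in> L2_unit \<Longrightarrow> f \<in> borel_measurable unit_measure"
  by (simp add: L2_unit_def)

lemma L2_unit_square_integrable: "f \<in> L2_unit \<Longrightarrow> integrable unit_measure (\<lambda>x. (cmod (f x))\<^sup>2)"
  by (simp add: L2_unit_def)

lemma L2_unit_bounded_mult:
  assumes f: "f \<in> L2_unit" and [measurable]: "b \<in> borel_measurable unit_measure"
    and b: "\<And>x. 0 < x \<Longrightarrow> x < 1 \<Longrightarrow> cmod (b x) \<le> B"
  shows "(\<lambda>x. b x * f x) \<in> L2_unit"
proof -
  have [measurable]: "f \<in> borel_measurable unit_measure" using f by measurable
  have "integrable unit_measure (\<lambda>x. B\<^sup>2 * (cmod (f x))\<^sup>2)"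
    using L2_unit_square_integrable[OF f] by simp
  then have "integrable unit_measure (\<lambda>x. (cmod (b x * f x))\<^sup>2)"
  proof (rule Bochner_Integration.integrable_bound)
    show "AE x in unit_measure. norm ((cmod (b x * f x))\<^sup>2) \<le> norm (B\<^sup>2 * (cmod (f x))\<^sup>2)"
      using b by (auto intro!: AE_I2 mult_right_mono power_mono simp: norm_mult power_mult_distrib)
  qed measurable
  then show ?thesis by (simp add: L2_unit_def)
qed

lemma L2_unit_cmult: "f \<in> L2_unit \<Longrightarrow> (\<lambda>x. c * f x) \<in> L2_unit"
  by (rule L2_unit_bounded_mult[where B = "cmod c"]) auto

lemma L2_unit_add:
  assumes f: "f \<in> L2_unit" and g: "g \<in> L2_unit"
  shows "(\<lambda>x. f x + g x) \<in> L2_unit"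
proof -
  have [measurable]: "f \<in> borel_measurable unit_measure" "g \<in> borel_measurable unit_measure"
    using f g by measurable
  have "integrable unit_measure (\<lambda>x. 2 * (cmod (f x))\<^sup>2 + 2 * (cmod (g x))\<^sup>2)"
    using L2_unit_square_integrable[OF f] L2_unit_square_integrable[OF g] by simp
  then have "integrable unit_measure (\<lambda>x. (cmod (f x + g x))\<^sup>2)"
  proof (rule Bochner_Integration.integrable_bound)
    show "AE x in unit_measure. norm ((cmod (f x + g x))\<^sup>2)
        \<le> norm (2 * (cmod (f x))\<^sup>2 + 2 * (cmod (g x))\<^sup>2)"
    proof (rule AE_I2)
      fix x
      have "(cmod (f x + g x))\<^sup>2 \<le> (cmod (f x) + cmod (g x))\<^sup>2"
        by (intro power_mono norm_triangle_ineq) auto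
      also have "\<dots> \<le> 2 * (cmod (f x))\<^sup>2 + 2 * (cmod (g x))\<^sup>2"
        using zero_le_power2[of "cmod (f x) - cmod (g x)"] by (simp add: power2_eq_square algebra_simps)
      finally show "norm ((cmod (f x + g x))\<^sup>2) \<le> norm (2 * (cmod (f x))\<^sup>2 + 2 * (cmod (g x))\<^sup>2)"
        by simp
    qed
  qed measurable
  then show ?thesis by (simp add: L2_unit_def)
qed

lemma L2_unit_zero [simp]: "(\<lambda>x. 0) \<in> L2_unit"
  by (simp add: L2_unit_def)

lemma L2_unit_diff: "f \<in> L2_unit \<Longrightarrow> g \<in> L2_unit \<Longrightarrow> (\<lambda>x. f x - g x) \<in> L2_unit"
  using L2_unit_add[of f "\<lambda>x. (-1) * g x"] L2_unit_cmult[of g "-1"] by simp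

lemma L2_unit_sum: "(\<And>m. m \<in> S \<Longrightarrow> f m \<in> L2_unit) \<Longrightarrow> (\<lambda>x. \<Sum>m\<in>S. f m x) \<in> L2_unit"
  by (induction S rule: infinite_finite_induct) (auto intro: L2_unit_add)

lemma L2_unit_character [simp]: "character s \<in> L2_unit"
  by (simp add: L2_unit_def)

lemma borel_measurable_cnj [measurable (raw)]:
  "f \<in> borel_measurable M \<Longrightarrow> (\<lambda>x. cnj (f x)) \<in> borel_measurable M"
  by (rule borel_measurable_continuous_on[where f = cnj]) (intro continuous_intros)

lemma integrable_L2_mult:
  assumes f: "f \<in> L2_unit" and g: "g \<in> L2_unit"
  shows "integrable unit_measure (\<lambda>x. f x * cnj (g x))"
proof -
  have [measurable]: "f \<in> borel_measurable unit_measure" "g \<in> borel_measurable unit_measure"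
    using f g by measurable
  have "integrable unit_measure (\<lambda>x. (cmod (f x))\<^sup>2 + (cmod (g x))\<^sup>2)"
    using L2_unit_square_integrable[OF f] L2_unit_square_integrable[OF g] by simp
  then show ?thesis
  proof (rule Bochner_Integration.integrable_bound)
    show "AE x in unit_measure. cmod (f x * cnj (g x)) \<le> norm ((cmod (f x))\<^sup>2 + (cmod (g x))\<^sup>2)"
    proof (rule AE_I2)
      fix x
      have "cmod (f x) * cmod (g x) \<le> (cmod (f x))\<^sup>2 + (cmod (g x))\<^sup>2"
        using sum_squares_bound[of "cmod (f x)" "cmod (g x)"] mult_nonneg_nonneg[OF norm_ge_zero[of "f x"] norm_ge_zero[of "g x"]]
        by linarith
      then show "cmod (f x * cnj (g x)) \<le> norm ((cmod (f x))\<^sup>2 + (cmod (g x))\<^sup>2)"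
        by (simp add: norm_mult)
    qed
  qed measurable
qed

lemma integrable_L2: "f \<in> L2_unit \<Longrightarrow> integrable unit_measure f"
  using integrable_L2_mult[of f "character 0"] by (simp add: character_def)

lemma L2_norm_sq: "(L2_norm f)\<^sup>2 = (LINT x|unit_measure. (cmod (f x))\<^sup>2)"
  by (simp add: L2_norm_def)

lemma L2_norm_nonneg [simp]: "0 \<le> L2_norm f"
  by (simp add: L2_norm_def)

section \<open>Linearity of the transform, and the transforms of characters\<close>

lemma fourier_add: "f \<in> L2_unit \<Longrightarrow> g \<in> L2_unit \<Longrightarrow> fourier (\<lambda>x. f x + g x) w = fourier f w + fourier g w"
  by (simp add: fourier_alt distrib_right integrable_L2_mult)

lemma fourier_diff: "f \<in> L2_unit \<Longrightarrow> g \<in> L2_unit \<Longrightarrow> fourier (\<lambda>x. f x - g x) w = fourier f w - fourier g w"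
  by (simp add: fourier_alt left_diff_distrib integrable_L2_mult)

lemma fourier_cmult: "fourier (\<lambda>x. c * f x) w = c * fourier f w"
  by (simp add: fourier_alt mult.assoc)

lemma fourier_zero: "fourier (\<lambda>x. 0) w = 0"
  by (simp add: fourier_alt)

lemma fourier_sum:
  "(\<And>m. m \<in> S \<Longrightarrow> f m \<in> L2_unit) \<Longrightarrow> fourier (\<lambda>x. \<Sum>m\<in>S. f m x) w = (\<Sum>m\<in>S. fourier (f m) w)"
  by (induction S rule: infinite_finite_induct) (auto simp: fourier_zero fourier_add L2_unit_sum)

lemma has_vector_derivative_cis:
  "((\<lambda>x. cis (a * x)) has_vector_derivative \<i> * of_real a * cis (a * x)) (at x within A)"
proof -
  have "((\<lambda>z. exp (\<i> * of_real a * z)) has_field_derivative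
      \<i> * of_real a * exp (\<i> * of_real a * of_real x)) (at (of_real x))"
    by (auto intro!: derivative_eq_intros)
  from has_vector_derivative_real_field[OF this] show ?thesis
    by (simp add: cis_conv_exp mult_ac)
qed

lemma integral_character:
  "(LINT x|unit_measure. character s x) =
     (if s = 0 then 1 else (cis (2 * pi * s) - 1) / (2 * pi * s * \<i>))"
proof (cases "s = 0")
  case True
  then show ?thesis by (simp add: character_def)
next
  case False
  have "((\<lambda>x. character s x / (2 * pi * s * \<i>)) has_vector_derivative character s x) (at x within {0..1})"
    for x
    using has_vector_derivative_divide[OF has_vector_derivative_cis[of "2 * pi * s" x "{0..1}"],
        of "2 * pi * s * \<i>"] False
    by (simp add: character_def[abs_def])
  then have "(character s has_integral
      (character s 1 / (2 * pi * s * \<i>) - character s 0 / (2 * pi * s * \<i>))) {0..1}"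
    by (intro fundamental_theorem_of_calculus) auto
  then have "(character s has_integral (cis (2 * pi * s) - 1) / (2 * pi * s * \<i>)) {0<..<1}"
    by (simp add: character_def diff_divide_distrib has_integral_Icc_iff_Ioo)
  moreover have "(character s has_integral (LINT x|unit_measure. character s x)) {0<..<1}"
    by (intro has_integral_integral_lebesgue_on integrable_L2) auto
  ultimately show ?thesis using False by (auto dest: has_integral_unique)
qed

lemma fourier_character:
  "fourier (character s) w =
     (if s = w then 1 else (cis (2 * pi * (s - w)) - 1) / (2 * pi * (s - w) * \<i>))"
  using integral_character[of "s - w"] by (simp add: fourier_alt cnj_character character_mult)

text \<open>The shift \<theta> cancels in the difference of frequencies, and \<open>cis\<close> is 1
  at integer multiples of \<open>2 * pi\<close>. So the characters on any shifted integer grid are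
  orthonormal; all shifts are wanted, because the energy integral later runs over them.\<close>

lemma fourier_character_int:
  "fourier (character (of_int k + \<theta>)) (of_int m + \<theta>) = (if k = m then 1 else 0)"
proof -
  have "cis (2 * pi * of_int (k - m)) = 1"
    by (metis cis_multiple_2pi Ints_of_int)
  then show ?thesis by (auto simp: fourier_character algebra_simps)
qed

section \<open>Orthogonal expansion and Bessel's inequality on shifted grids\<close>

lemma integral_L2_mult_char_sum:
  assumes "f \<in> L2_unit" "finite S"
  shows "(LINT x|unit_measure. f x * cnj (\<Sum>m\<in>S. c m * character (s m) x)) =
      (\<Sum>m\<in>S. cnj (c m) * fourier f (s m))"
proof -
  have "(LINT x|unit_measure. f x * cnj (\<Sum>m\<in>S. c m * character (s m) x)) =
     (LINT x|unit_measure. (\<Sum>m\<in>S. cnj (c m) * (f x * cnj (character (s m) x))))"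
    by (simp add: sum_distrib_left mult_ac)
  also have "\<dots> = (\<Sum>m\<in>S. cnj (c m) * fourier f (s m))"
    using assms by (subst Bochner_Integration.integral_sum) (auto simp: fourier_alt integrable_L2_mult)
  finally show ?thesis .
qed

text \<open>Expand the square, use orthonormality, and complete the square in each coefficient. This
  one identity serves three purposes: \<open>f = 0\<close> gives the norm of a character sum, the
  Fourier coefficients as \<open>c\<close> give Bessel's inequality, and general \<open>c\<close>
  measures the excess over the best approximation.\<close>

lemma L2_norm_diff_char_sum:
  fixes c :: "int \<Rightarrow> complex"
  assumes f: "f \<in> L2_unit" and S: "finite S"
  shows "(L2_norm (\<lambda>x. f x - (\<Sum>m\<in>S. c m * character (of_int m + \<theta>) x)))\<^sup>2 =
      (L2_norm f)\<^sup>2 - (\<Sum>m\<in>S. (cmod (fourier f (of_int m + \<theta>)))\<^sup>2)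
        + (\<Sum>m\<in>S. (cmod (c m - fourier f (of_int m + \<theta>)))\<^sup>2)"
proof -
  define g where "g = (\<lambda>x. \<Sum>m\<in>S. c m * character (of_int m + \<theta>) x)"
  let ?F = "\<lambda>m. fourier f (of_int m + \<theta>)"
  have g: "g \<in> L2_unit"
    unfolding g_def by (intro L2_unit_sum L2_unit_cmult) auto
  have Fg: "fourier g (of_int m + \<theta>) = c m" if "m \<in> S" for m
    unfolding g_def using S that
    by (simp add: fourier_sum L2_unit_cmult fourier_cmult fourier_character_int if_distrib sum.delta cong: if_cong)
  have fg: "(LINT x|unit_measure. f x * cnj (g x)) = (\<Sum>m\<in>S. cnj (c m) * ?F m)"
    unfolding g_def by (rule integral_L2_mult_char_sum[OF f S])
  have "(LINT x|unit_measure. g x * cnj (g x)) = (\<Sum>m\<in>S. cnj (c m) * c m)"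
    using integral_L2_mult_char_sum[OF g S, of c "\<lambda>m. of_int m + \<theta>"] Fg by (simp add: g_def)
  moreover have "(LINT x|unit_measure. g x * cnj (g x)) = of_real ((L2_norm g)\<^sup>2)"
    unfolding L2_norm_sq complex_norm_square[symmetric] by (rule integral_complex_of_real)
  ultimately have gg: "(L2_norm g)\<^sup>2 = (\<Sum>m\<in>S. (cmod (c m))\<^sup>2)"
    by (simp only: mult.commute[of "cnj _"] complex_norm_square[symmetric] of_real_sum[symmetric] of_real_eq_iff)
  have pt: "(cmod (f x - g x))\<^sup>2 = (cmod (f x))\<^sup>2 + (cmod (g x))\<^sup>2 - 2 * Re (f x * cnj (g x))" for x
    unfolding cmod_power2 by (simp add: power2_eq_square algebra_simps)
  have "(L2_norm (\<lambda>x. f x - g x))\<^sup>2 =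
      (L2_norm f)\<^sup>2 + (L2_norm g)\<^sup>2 - 2 * (LINT x|unit_measure. Re (f x * cnj (g x)))"
    unfolding L2_norm_sq pt using L2_unit_square_integrable[OF f] L2_unit_square_integrable[OF g]
      integrable_Re[OF integrable_L2_mult[OF f g]] by (simp del: times_complex.sel)
  also have "(LINT x|unit_measure. Re (f x * cnj (g x))) = (\<Sum>m\<in>S. Re (cnj (c m) * ?F m))"
    using integral_Re[OF integrable_L2_mult[OF f g]] unfolding fg by simp
  finally have "(L2_norm (\<lambda>x. f x - g x))\<^sup>2 =
      (L2_norm f)\<^sup>2 + (\<Sum>m\<in>S. (cmod (c m))\<^sup>2 - 2 * Re (cnj (c m) * ?F m))"
    by (simp add: gg sum_subtractf sum_distrib_left)
  also have "(\<lambda>m. (cmod (c m))\<^sup>2 - 2 * Re (cnj (c m) * ?F m)) =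
      (\<lambda>m. (cmod (c m - ?F m))\<^sup>2 - (cmod (?F m))\<^sup>2)"
    unfolding cmod_power2 by (simp add: power2_eq_square algebra_simps)
  finally show ?thesis by (simp add: g_def sum_subtractf)
qed

lemma L2_norm_char_sum:
  fixes c :: "int \<Rightarrow> complex"
  assumes "finite S"
  shows "(L2_norm (\<lambda>x. \<Sum>m\<in>S. c m * character (of_int m) x))\<^sup>2 = (\<Sum>m\<in>S. (cmod (c m))\<^sup>2)"
  using L2_norm_diff_char_sum[of "\<lambda>x. 0" S c 0] assms by (simp add: fourier_zero L2_norm_def sum_nonneg)

lemma bessel_inequality:
  fixes S :: "int set"
  assumes f: "f \<in> L2_unit" and S: "finite S"
  shows "(\<Sum>m\<in>S. (cmod (fourier f (of_int m + \<theta>)))\<^sup>2) \<le> (L2_norm f)\<^sup>2"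
  using L2_norm_diff_char_sum[OF f S, of "\<lambda>m. fourier f (of_int m + \<theta>)" \<theta>]
    zero_le_power2[of "L2_norm (\<lambda>x. f x - (\<Sum>m\<in>S. fourier f (of_int m + \<theta>) * character (of_int m + \<theta>) x))"]
  by (simp del: zero_le_power2)

section \<open>Differentiability of the transform\<close>

lemma cis_approx: "cmod (cis t - 1 - \<i> * of_real t) \<le> t\<^sup>2 / 2"
  using iexp_approx1[of t 1] by (simp add: cis_conv_exp power2_eq_square diff_diff_eq fact_numeral)

text \<open>The second-order Taylor remainder of the character is at most
  \<open>2 * pi\<^sup>2 * (v - w)\<^sup>2\<close>, uniformly for \<open>x\<close> in the unit
  interval. Integrated against the integrable function \<open>cmod (f x)\<close> it gives an error
  quadratic in \<open>v - w\<close>.\<close>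

lemma fourier_has_vector_derivative:
  assumes f: "f \<in> L2_unit"
  shows "(fourier f has_vector_derivative fourier (\<lambda>x. - (2 * pi * \<i> * x) * f x) w) (at w)"
proof -
  let ?h = "\<lambda>x. - (2 * pi * \<i> * of_real x) * f x"
  have m: "(\<lambda>x. - (2 * pi * \<i> * of_real x)) \<in> borel_measurable unit_measure"
    by (intro borel_measurable_unit_continuous continuous_intros)
  have h: "?h \<in> L2_unit"
    by (rule L2_unit_bounded_mult[OF f m, where B = "2 * pi"]) (auto simp: norm_mult)
  define J where "J = (LINT x|unit_measure. cmod (f x))"
  have J: "J \<ge> 0" unfolding J_def by (intro Bochner_Integration.integral_nonneg) auto
  have est: "cmod (fourier f v - fourier f w - (v - w) *\<^sub>R fourier ?h w) \<le> (2 * pi\<^sup>2 * J) * \<bar>v - w\<bar>\<^sup>2" for v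
  proof -
    let ?r = "\<lambda>x. f x * cnj (character v x) - f x * cnj (character w x) - of_real (v - w) * (?h x * cnj (character w x))"
    have i1: "integrable unit_measure (\<lambda>x. f x * cnj (character v x) - f x * cnj (character w x))"
      by (intro Bochner_Integration.integrable_diff integrable_L2_mult f L2_unit_character)
    have i2: "integrable unit_measure (\<lambda>x. of_real (v - w) * (?h x * cnj (character w x)))"
      by (intro integrable_mult_right integrable_L2_mult h L2_unit_character)
    have i: "integrable unit_measure ?r"
      using i1 i2 by (rule Bochner_Integration.integrable_diff)
    have "(LINT x|unit_measure. ?r x) =
        (LINT x|unit_measure. f x * cnj (character v x) - f x * cnj (character w x)) -
        (LINT x|unit_measure. of_real (v - w) * (?h x * cnj (character w x)))"
      by (rule Bochner_Integration.integral_diff[OF i1 i2])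
    also have "(LINT x|unit_measure. f x * cnj (character v x) - f x * cnj (character w x)) =
        fourier f v - fourier f w"
      unfolding fourier_alt
      by (intro Bochner_Integration.integral_diff integrable_L2_mult f L2_unit_character)
    also have "(LINT x|unit_measure. of_real (v - w) * (?h x * cnj (character w x))) =
        (v - w) *\<^sub>R fourier ?h w"
      unfolding fourier_alt scaleR_conv_of_real by (rule integral_mult_right_zero)
    finally have "cmod (fourier f v - fourier f w - (v - w) *\<^sub>R fourier ?h w) \<le>
        (LINT x|unit_measure. cmod (?r x))"
      using integral_norm_bound[of unit_measure ?r] by simp
    also have "\<dots> \<le> (LINT x|unit_measure. (2 * pi\<^sup>2 * (v - w)\<^sup>2) * cmod (f x))"
    proof (rule Bochner_Integration.integral_mono)
      show "integrable unit_measure (\<lambda>x. cmod (?r x))"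
        using i by (rule integrable_norm)
      show "integrable unit_measure (\<lambda>x. (2 * pi\<^sup>2 * (v - w)\<^sup>2) * cmod (f x))"
        using integrable_L2[OF f] by auto
      fix x assume "x \<in> space unit_measure"
      then have x: "0 < x" "x < 1" by auto
      let ?t = "- (2 * pi * (v - w) * x)"
      have "?r x = f x * cnj (character w x) * (cis ?t - 1 - \<i> * of_real ?t)"
      proof -
        have "cnj (character v x) = cnj (character w x) * cis ?t"
          by (simp add: character_def cis_cnj cis_mult algebra_simps)
        then show ?thesis by (simp add: algebra_simps)
      qed
      then have "cmod (?r x) = cmod (f x) * cmod (cis ?t - 1 - \<i> * of_real ?t)"
        by (simp add: norm_mult)
      also have "\<dots> \<le> cmod (f x) * (2 * pi\<^sup>2 * (v - w)\<^sup>2)"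
      proof (rule mult_left_mono)
        have "cmod (cis ?t - 1 - \<i> * of_real ?t) \<le> ?t\<^sup>2 / 2"
          by (rule cis_approx)
        also have "\<dots> = 2 * pi\<^sup>2 * (v - w)\<^sup>2 * x\<^sup>2"
          by (simp add: power2_eq_square)
        also have "\<dots> \<le> 2 * pi\<^sup>2 * (v - w)\<^sup>2 * 1"
          using x by (intro mult_left_mono power_le_one) auto
        finally show "cmod (cis ?t - 1 - \<i> * of_real ?t) \<le> 2 * pi\<^sup>2 * (v - w)\<^sup>2" by simp
      qed simp
      finally show "cmod (?r x) \<le> (2 * pi\<^sup>2 * (v - w)\<^sup>2) * cmod (f x)"
        by (simp only: mult.commute)
    qed
    also have "\<dots> = (2 * pi\<^sup>2 * J) * \<bar>v - w\<bar>\<^sup>2" by (simp add: J_def)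
    finally show ?thesis .
  qed
  show ?thesis
    unfolding has_vector_derivative_def has_derivative_at_alt
  proof (intro conjI allI impI)
    show "bounded_linear (\<lambda>x. x *\<^sub>R fourier ?h w)" by (rule bounded_linear_scaleR_left)
    fix e :: real assume e: "e > 0"
    \<comment> \<open>The summand 1 keeps the denominator positive when
      \<open>J = 0\<close>.\<close>
    define d where "d = e / (2 * pi\<^sup>2 * J + 1)"
    have den: "2 * pi\<^sup>2 * J + 1 > 0" using J by (intro add_nonneg_pos) auto
    have "cmod (fourier f v - fourier f w - (v - w) *\<^sub>R fourier ?h w) \<le> e * norm (v - w)"
      if "norm (v - w) < d" for v
    proof -
      have "(2 * pi\<^sup>2 * J) * \<bar>v - w\<bar> \<le> (2 * pi\<^sup>2 * J + 1) * d"
        using that J e by (intro mult_mono) (auto simp: d_def)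
      also have "\<dots> = e" using den by (simp add: d_def)
      finally have "((2 * pi\<^sup>2 * J) * \<bar>v - w\<bar>) * \<bar>v - w\<bar> \<le> e * \<bar>v - w\<bar>"
        by (intro mult_right_mono) auto
      then show ?thesis using est[of v] by (simp add: power2_eq_square mult.assoc)
    qed
    moreover have "d > 0" using e den by (simp add: d_def)
    ultimately show "\<exists>d>0. \<forall>v. norm (v - w) < d \<longrightarrow>
        cmod (fourier f v - fourier f w - (v - w) *\<^sub>R fourier ?h w) \<le> e * norm (v - w)"
      by blast
  qed
qed

lemma continuous_on_fourier: "f \<in> L2_unit \<Longrightarrow> continuous_on A (fourier f)"
  by (meson continuous_at_imp_continuous_on fourier_has_vector_derivative has_vector_derivative_continuous)

section \<open>Energy of the transform on bounded bands\<close>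

lemma fourier_square_integrable:
  "f \<in> L2_unit \<Longrightarrow> (\<lambda>w. (cmod (fourier f w))\<^sup>2) integrable_on {a..b}"
  by (intro integrable_continuous_real continuous_intros continuous_on_fourier)

text \<open>Cut the interval into unit pieces and stack them over \<open>{0..1}\<close>. For each
  \<open>t\<close> the stacked values lie on one shifted integer grid, the setting of
  \<open>bessel_inequality\<close>.\<close>

lemma integral_unit_periodization:
  fixes g :: "real \<Rightarrow> real"
  assumes g: "continuous_on UNIV g"
  shows "integral {a..a + real k} g = integral {0..1} (\<lambda>t. \<Sum>j<k. g (real j + (a + t)))"
proof (induction k)
  case 0
  then show ?case by simp
next
  case (Suc k)
  have c: "continuous_on A g" for A using g continuous_on_subset by blast
  have "integral {a..a + real (Suc k)} g =
      integral {a..a + real k} g + integral {a + real k..a + real (Suc k)} g"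
    by (intro Henstock_Kurzweil_Integration.integral_combine[symmetric] integrable_continuous_real c) auto
  also have "integral {a + real k..a + real (Suc k)} g = integral {0..1} (\<lambda>t. g (real k + (a + t)))"
    using integral_shift[of 0 "a + real k" 1 g] c by (simp add: o_def add_ac)
  also have "integral {a..a + real k} g + \<dots> = integral {0..1} (\<lambda>t. \<Sum>j<Suc k. g (real j + (a + t)))"
    unfolding Suc sum.lessThan_Suc
    by (intro Henstock_Kurzweil_Integration.integral_add[symmetric] integrable_continuous_real
        continuous_intros continuous_on_compose2[OF g]) auto
  finally show ?case .
qed

text \<open>Only Bessel's inequality on each shifted integer grid enters, not Plancherel's theorem.\<close>

lemma fourier_energy_le:
  assumes f: "f \<in> L2_unit"
  shows "integral {a..b} (\<lambda>w. (cmod (fourier f w))\<^sup>2) \<le> (L2_norm f)\<^sup>2"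
proof -
  let ?g = "\<lambda>w. (cmod (fourier f w))\<^sup>2"
  have g: "continuous_on UNIV ?g" by (intro continuous_intros continuous_on_fourier f)
  obtain k :: nat where k: "b - a \<le> real k" using real_arch_simple by blast
  have "integral {a..b} ?g \<le> integral {a..a + real k} ?g"
    using k by (intro integral_subset_le fourier_square_integrable f) auto
  also have "\<dots> = integral {0..1} (\<lambda>t. \<Sum>j<k. ?g (real j + (a + t)))"
    by (rule integral_unit_periodization[OF g])
  also have "\<dots> \<le> integral {0..1::real} (\<lambda>t. (L2_norm f)\<^sup>2)"
  proof (rule integral_le)
    show "(\<lambda>t. \<Sum>j<k. ?g (real j + (a + t))) integrable_on {0..1}"
      by (intro integrable_continuous_real continuous_intros continuous_on_compose2[OF g]) auto
    fix t :: real
    show "(\<Sum>j<k. ?g (real j + (a + t))) \<le> (L2_norm f)\<^sup>2"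
      using bessel_inequality[OF f, of "int ` {..<k}" "a + t"] by (simp add: sum.reindex)
  qed auto
  finally show ?thesis by simp
qed

section \<open>Wirtinger's inequality\<close>

text \<open>The strict inequality \<open>k * L < pi / 2\<close> leaves room for the positive phase
  in \<open>y\<close>; the sharp constant is reached afterwards by a limit.\<close>

lemma wirtinger_left_aux:
  fixes u u' :: "real \<Rightarrow> 'a::real_inner"
  assumes u: "\<And>x. (u has_vector_derivative u' x) (at x)"
    and u': "continuous_on UNIV u'" and u0: "u a = 0"
    and ab: "a \<le> b" "b - a \<le> L" and k: "0 < k" "k * L < pi / 2"
  shows "k\<^sup>2 * integral {a..b} (\<lambda>x. (norm (u x))\<^sup>2) \<le> integral {a..b} (\<lambda>x. (norm (u' x))\<^sup>2)"
proof -
  define y where "y x = k * (x - a) + (pi / 2 - k * L)" for x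
  \<comment> \<open>\<open>|u'|\<^sup>2 - k\<^sup>2 |u|\<^sup>2 = |u' - k cot y u|\<^sup>2 + P'\<close>. The phase in \<open>y\<close> keeps \<open>cot\<close> regular at \<open>a\<close>.\<close>
  define P where "P x = (norm (u x))\<^sup>2 * (k * cot (y x))" for x
  define P' where "P' x = 2 * (u x \<bullet> u' x) * (k * cot (y x)) - (norm (u x))\<^sup>2 * (k\<^sup>2 / (sin (y x))\<^sup>2)" for x
  have y: "0 < y x" "y x \<le> pi / 2" if "x \<in> {a..b}" for x
  proof -
    have "0 \<le> k * (x - a)" using that k by auto
    then show "0 < y x" using k by (simp add: y_def)
    have "k * (x - a) \<le> k * L" using that k ab by (intro mult_left_mono) auto
    then show "y x \<le> pi / 2" by (simp add: y_def)
  qed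
  have s: "sin (y x) > 0" if "x \<in> {a..b}" for x
    using y[OF that] pi_gt_zero by (intro sin_gt_zero) linarith+
  have cu: "continuous_on A u" for A
    by (meson continuous_at_imp_continuous_on has_vector_derivative_continuous u)
  have cu': "continuous_on A u'" for A
    using u' continuous_on_subset by blast
  have "(P has_vector_derivative P' x) (at x within {a..b})" if x: "x \<in> {a..b}" for x
  proof -
    have "((\<lambda>x. cot (y x)) has_real_derivative (- inverse ((sin (y x))\<^sup>2) * k)) (at x)"
      using s[OF x] unfolding y_def
      by (intro DERIV_chain2[where f = cot] DERIV_cot) (auto intro!: derivative_eq_intros)
    then have c: "((\<lambda>x. k * cot (y x)) has_real_derivative (- (k\<^sup>2 / (sin (y x))\<^sup>2))) (at x)"
      by (auto intro!: derivative_eq_intros simp: power2_eq_square field_simps)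
    have "((\<lambda>x. u x \<bullet> u x) has_vector_derivative (u x \<bullet> u' x + u' x \<bullet> u x)) (at x)"
      using bounded_bilinear.has_vector_derivative[OF bounded_bilinear_inner u u] .
    then have "((\<lambda>x. (norm (u x))\<^sup>2) has_real_derivative (2 * (u x \<bullet> u' x))) (at x)"
      by (simp add: has_real_derivative_iff_has_vector_derivative power2_norm_eq_inner inner_commute)
    from DERIV_mult[OF this c] have "(P has_real_derivative P' x) (at x)"
      unfolding P_def[abs_def] P'_def by (simp add: algebra_simps)
    then show ?thesis
      by (simp add: has_real_derivative_iff_has_vector_derivative has_vector_derivative_at_within)
  qed
  then have P': "(P' has_integral (P b - P a)) {a..b}"
    by (intro fundamental_theorem_of_calculus ab)
  have "P a = 0" by (simp add: P_def u0)
  \<comment> \<open>No boundary condition is imposed at \<open>b\<close>: there \<open>y\<close> is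
    still at most \<open>pi / 2\<close>, so the cotangent is nonnegative and the boundary term has
    the favourable sign.\<close>
  moreover have "0 \<le> P b"
  proof -
    have "cos (y b) \<ge> 0" using y[of b] ab by (intro cos_ge_zero) auto
    then show ?thesis using s[of b] ab k by (simp add: P_def cot_def)
  qed
  ultimately have "0 \<le> integral {a..b} P'" using P' by (simp add: integral_unique)
  also have "\<dots> \<le> integral {a..b} (\<lambda>x. (norm (u' x))\<^sup>2 - k\<^sup>2 * (norm (u x))\<^sup>2)"
  proof (rule integral_le)
    show "P' integrable_on {a..b}" using P' by blast
    show "(\<lambda>x. (norm (u' x))\<^sup>2 - k\<^sup>2 * (norm (u x))\<^sup>2) integrable_on {a..b}"
      by (intro integrable_continuous_real continuous_intros cu cu')
    fix x assume x: "x \<in> {a..b}"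
    define c where "c = cot (y x)"
    \<comment> \<open>The derivative of the cotangent thus supplies both the term in
      \<open>k\<^sup>2\<close> and the term in \<open>k\<^sup>2 * c\<^sup>2\<close> that completes
      the square.\<close>
    have c: "1 / (sin (y x))\<^sup>2 = 1 + c\<^sup>2"
      using s[OF x] unfolding c_def cot_def
      by (simp add: field_simps)
    have "0 \<le> (norm (u' x - (k * c) *\<^sub>R u x))\<^sup>2" by simp
    also have "\<dots> = (norm (u' x))\<^sup>2 - 2 * (u x \<bullet> u' x) * (k * c) + k\<^sup>2 * c\<^sup>2 * (norm (u x))\<^sup>2"
      unfolding power2_norm_eq_inner
      by (simp add: inner_diff_left inner_diff_right inner_commute power2_eq_square algebra_simps)
    also have "\<dots> = ((norm (u' x))\<^sup>2 - k\<^sup>2 * (norm (u x))\<^sup>2) - P' x"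
      unfolding P'_def c_def[symmetric] times_divide_eq_right[symmetric]
        divide_inverse[of "k\<^sup>2"] inverse_eq_divide c by (simp add: algebra_simps)
    finally show "P' x \<le> (norm (u' x))\<^sup>2 - k\<^sup>2 * (norm (u x))\<^sup>2" by simp
  qed
  also have "\<dots> = integral {a..b} (\<lambda>x. (norm (u' x))\<^sup>2) - k\<^sup>2 * integral {a..b} (\<lambda>x. (norm (u x))\<^sup>2)"
    by (subst Henstock_Kurzweil_Integration.integral_diff)
      (auto intro!: integrable_continuous_real continuous_intros cu cu')
  finally show ?thesis by simp
qed

text \<open>At the sharp value \<open>k = pi / (2 * L)\<close> the phase in
  \<open>wirtinger_left_aux\<close> vanishes and the cotangent has a pole at \<open>a\<close>. Both
  integrals are independent of \<open>k\<close>, so the inequality is passed to the limit from the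
  left.\<close>

lemma wirtinger_left:
  fixes u u' :: "real \<Rightarrow> 'a::real_inner"
  assumes u: "\<And>x. (u has_vector_derivative u' x) (at x)"
    and u': "continuous_on UNIV u'" and u0: "u a = 0"
    and ab: "a \<le> b" "b - a \<le> L" and L: "0 < L"
  shows "integral {a..b} (\<lambda>x. (norm (u x))\<^sup>2) \<le> (2 * L / pi)\<^sup>2 * integral {a..b} (\<lambda>x. (norm (u' x))\<^sup>2)"
proof -
  let ?I = "integral {a..b} (\<lambda>x. (norm (u x))\<^sup>2)" and ?I' = "integral {a..b} (\<lambda>x. (norm (u' x))\<^sup>2)"
  let ?k = "pi / (2 * L)"
  have "((\<lambda>k. k\<^sup>2 * ?I) \<longlongrightarrow> ?k\<^sup>2 * ?I) (at_left ?k)"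
    by (intro tendsto_intros)
  moreover have "eventually (\<lambda>k. k \<in> {0<..<?k}) (at_left ?k)"
    using L by (intro eventually_at_left_real) auto
  then have "eventually (\<lambda>k. k\<^sup>2 * ?I \<le> ?I') (at_left ?k)"
  proof eventually_elim
    case (elim k)
    then show ?case using L by (intro wirtinger_left_aux[OF u u' u0 ab]) (auto simp: field_simps)
  qed
  ultimately have "?k\<^sup>2 * ?I \<le> ?I'"
    by (rule tendsto_upperbound) simp
  then have "(2 * L / pi)\<^sup>2 * (?k\<^sup>2 * ?I) \<le> (2 * L / pi)\<^sup>2 * ?I'"
    by (intro mult_left_mono) auto
  moreover have "(2 * L / pi)\<^sup>2 * (?k\<^sup>2 * ?I) = ?I"
    using L by (simp add: power2_eq_square)
  ultimately show ?thesis by simp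
qed

lemma wirtinger_right:
  fixes u u' :: "real \<Rightarrow> 'a::real_inner"
  assumes u: "\<And>x. (u has_vector_derivative u' x) (at x)"
    and u': "continuous_on UNIV u'" and u0: "u b = 0"
    and ab: "a \<le> b" "b - a \<le> L" and L: "0 < L"
  shows "integral {a..b} (\<lambda>x. (norm (u x))\<^sup>2) \<le> (2 * L / pi)\<^sup>2 * integral {a..b} (\<lambda>x. (norm (u' x))\<^sup>2)"
proof -
  have "((\<lambda>x. u (- x)) has_vector_derivative - u' (- x)) (at x)" for x
  proof -
    have "(uminus has_vector_derivative - 1) (at x)"
      by (auto simp: has_vector_derivative_def intro!: derivative_eq_intros)
    from vector_diff_chain_at[OF this u] show ?thesis by (simp add: o_def)
  qed
  moreover have "continuous_on UNIV (\<lambda>x. - u' (- x))"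
    by (intro continuous_intros continuous_on_compose2[OF u']) auto
  ultimately have "integral {-b..-a} (\<lambda>x. (norm (u (- x)))\<^sup>2) \<le>
      (2 * L / pi)\<^sup>2 * integral {-b..-a} (\<lambda>x. (norm (- u' (- x)))\<^sup>2)"
    using ab L u0 by (intro wirtinger_left) auto
  then show ?thesis
    using Henstock_Kurzweil_Integration.integral_reflect_real[of b a "\<lambda>x. (norm (u x))\<^sup>2"]
      Henstock_Kurzweil_Integration.integral_reflect_real[of b a "\<lambda>x. (norm (u' x))\<^sup>2"]
    by simp
qed

text \<open>\<open>u x - u p\<close> vanishes at \<open>p\<close>, which is an endpoint of each of
  the two halves. The constant is governed by a bound on the halves, so \<open>p\<close> may lie off
  centre in the cell.\<close>

lemma wirtinger_cell:
  fixes u u' :: "real \<Rightarrow> 'a::real_inner"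
  assumes u: "\<And>x. (u has_vector_derivative u' x) (at x)" and u': "continuous_on UNIV u'"
    and p: "a \<le> p" "p \<le> b" "p - a \<le> L" "b - p \<le> L" and L: "0 < L"
  shows "integral {a..b} (\<lambda>x. (norm (u x - u p))\<^sup>2) \<le> (2 * L / pi)\<^sup>2 * integral {a..b} (\<lambda>x. (norm (u' x))\<^sup>2)"
proof -
  let ?v = "\<lambda>x. u x - u p"
  have v: "(?v has_vector_derivative u' x) (at x)" for x
    using has_vector_derivative_diff[OF u has_vector_derivative_const] by simp
  have cv: "continuous_on A ?v" for A
    by (intro continuous_at_imp_continuous_on ballI has_vector_derivative_continuous[OF v])
  have cu': "continuous_on A u'" for A
    using u' continuous_on_subset by blast
  have split: "integral {a..b} g = integral {a..p} g + integral {p..b} g"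
    if "continuous_on UNIV g" for g :: "real \<Rightarrow> real"
    using that p
    by (intro Henstock_Kurzweil_Integration.integral_combine[symmetric] integrable_continuous_real)
      (auto intro: continuous_on_subset)
  have "integral {a..b} (\<lambda>x. (norm (?v x))\<^sup>2) =
      integral {a..p} (\<lambda>x. (norm (?v x))\<^sup>2) + integral {p..b} (\<lambda>x. (norm (?v x))\<^sup>2)"
    by (intro split continuous_intros cv)
  also have "\<dots> \<le> (2 * L / pi)\<^sup>2 * integral {a..p} (\<lambda>x. (norm (u' x))\<^sup>2)
      + (2 * L / pi)\<^sup>2 * integral {p..b} (\<lambda>x. (norm (u' x))\<^sup>2)"
    by (intro add_mono wirtinger_left[OF v u'] wirtinger_right[OF v u'] p L) auto
  also have "\<dots> = (2 * L / pi)\<^sup>2 * integral {a..b} (\<lambda>x. (norm (u' x))\<^sup>2)"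
    by (subst split) (auto intro!: continuous_intros cu' simp: algebra_simps)
  finally show ?thesis .
qed

section \<open>Frequency concentration of trigonometric polynomials\<close>

text \<open>The odd antiderivative of \<open>(sinc (pi * t))\<^sup>2\<close>, found by integration
  by parts. Writing the boundary term with \<open>sinc\<close> makes it continuous at 0.\<close>

definition sinc_square_primitive :: "real \<Rightarrow> real" where
  "sinc_square_primitive t = Si (2 * pi * t) / pi - t * (sinc (pi * t))\<^sup>2"

lemma sinc_square_primitive_nonzero:
  "t \<noteq> 0 \<Longrightarrow> sinc_square_primitive t = Si (2 * pi * t) / pi - (sin (pi * t))\<^sup>2 / (pi\<^sup>2 * t)"
  by (simp add: sinc_square_primitive_def power2_eq_square field_simps)

lemma continuous_on_sinc_square_primitive: "continuous_on A sinc_square_primitive"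
proof -
  have Si: "continuous_on UNIV Si" by (simp add: continuous_at_imp_continuous_on isCont_Si)
  have sinc: "continuous_on UNIV sinc" by (rule continuous_on_sinc[OF continuous_on_id])
  have "continuous_on A (\<lambda>t. Si (2 * pi * t) / pi - t * (sinc (pi * t))\<^sup>2)"
    by (intro continuous_intros continuous_on_compose2[OF Si] continuous_on_compose2[OF sinc]) auto
  then show ?thesis by (simp add: sinc_square_primitive_def[abs_def])
qed

lemma DERIV_Si_scaled: "t \<noteq> 0 \<Longrightarrow>
  ((\<lambda>t. Si (2 * pi * t) / pi) has_real_derivative 2 * sin (pi * t) * cos (pi * t) / (pi * t)) (at t)"
  using DERIV_cdivide[OF DERIV_chain2[where f = Si and g = "\<lambda>t. 2 * pi * t", OF DERIV_Si DERIV_cmult_Id], where x = t and c = pi]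
    sin_double[of "pi * t"]
  by (simp add: mult.assoc field_simps)

lemma DERIV_sinc_square_primitive:
  assumes t: "t \<noteq> 0"
  shows "(sinc_square_primitive has_real_derivative (sin (pi * t) / (pi * t))\<^sup>2) (at t)"
proof -
  have "((\<lambda>t. (sin (pi * t))\<^sup>2 / (pi\<^sup>2 * t)) has_real_derivative
      2 * sin (pi * t) * cos (pi * t) / (pi * t) - (sin (pi * t) / (pi * t))\<^sup>2) (at t)"
    using t by (auto intro!: derivative_eq_intros simp: power2_eq_square field_simps)
  from DERIV_diff[OF DERIV_Si_scaled[OF t] this]
  have "((\<lambda>t. Si (2 * pi * t) / pi - (sin (pi * t))\<^sup>2 / (pi\<^sup>2 * t)) has_real_derivative
      (sin (pi * t) / (pi * t))\<^sup>2) (at t)" by simp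
  then show ?thesis
    by (rule has_field_derivative_transform_within_open[where S = "- {0}"])
      (use t in \<open>auto simp: sinc_square_primitive_nonzero\<close>)
qed

text \<open>Adding \<open>1 / (pi\<^sup>2 * t)\<close> gives a nonincreasing function, since the
  square of the sine is at most 1. Its limit at infinity is \<open>1 / 2\<close>, because
  \<open>Si\<close> tends to \<open>pi / 2\<close>.\<close>

lemma sinc_square_primitive_ge:
  assumes "0 < t"
  shows "1 / 2 - 1 / (pi\<^sup>2 * t) \<le> sinc_square_primitive t"
proof -
  let ?h = "\<lambda>t. sinc_square_primitive t + 1 / (pi\<^sup>2 * t)"
  have mono: "?h s \<le> ?h t" if "t \<le> s" for s
  proof (rule DERIV_nonpos_imp_nonincreasing[OF that])
    fix x assume x: "t \<le> x" "x \<le> s"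
    then have x0: "x \<noteq> 0" using assms by simp
    have "((\<lambda>t. 1 / (pi\<^sup>2 * t)) has_real_derivative - (1 / (pi * x)\<^sup>2)) (at x)"
      using x0 by (auto intro!: derivative_eq_intros simp: power2_eq_square field_simps)
    from DERIV_add[OF DERIV_sinc_square_primitive[OF x0] this]
    have "(?h has_real_derivative (sin (pi * x) / (pi * x))\<^sup>2 - 1 / (pi * x)\<^sup>2) (at x)"
      by simp
    moreover have "(sin (pi * x) / (pi * x))\<^sup>2 - 1 / (pi * x)\<^sup>2 \<le> 0"
      unfolding power_divide diff_divide_distrib[symmetric]
      by (intro divide_nonpos_nonneg) (auto simp: abs_square_le_1)
    ultimately show "\<exists>y. (?h has_real_derivative y) (at x) \<and> y \<le> 0" by blast
  qed
  have "((\<lambda>s. Si (2 * pi * s)) \<longlongrightarrow> pi / 2) at_top"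
    by (rule filterlim_compose[OF Si_at_top])
      (auto intro!: filterlim_tendsto_pos_mult_at_top[OF tendsto_const] filterlim_ident)
  \<comment> \<open>The squared sine of the primitive and the added 1 combine into a squared cosine
    over \<open>pi\<^sup>2 * s\<close>.\<close>
  moreover have "((\<lambda>s. (cos (pi * s))\<^sup>2 / (pi\<^sup>2 * s)) \<longlongrightarrow> 0) at_top"
  proof (rule Lim_null_comparison)
    show "eventually (\<lambda>s. norm ((cos (pi * s))\<^sup>2 / (pi\<^sup>2 * s)) \<le> 1 / (pi\<^sup>2 * s)) at_top"
      using eventually_gt_at_top[of 0]
      by eventually_elim (auto simp: abs_square_le_1 intro!: divide_right_mono)
    show "((\<lambda>s. 1 / (pi\<^sup>2 * s)) \<longlongrightarrow> 0) at_top"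
      by real_asymp
  qed
  ultimately have "((\<lambda>s. Si (2 * pi * s) / pi + (cos (pi * s))\<^sup>2 / (pi\<^sup>2 * s)) \<longlongrightarrow> pi / 2 / pi + 0) at_top"
    by (intro tendsto_intros) auto
  moreover have "eventually (\<lambda>s. Si (2 * pi * s) / pi + (cos (pi * s))\<^sup>2 / (pi\<^sup>2 * s) = ?h s) at_top"
    using eventually_gt_at_top[of 0]
    by eventually_elim (auto simp: sinc_square_primitive_nonzero cos_squared_eq diff_divide_distrib)
  ultimately have "(?h \<longlongrightarrow> pi / 2 / pi + 0) at_top"
    by (rule Lim_transform_eventually)
  moreover have "eventually (\<lambda>s. ?h s \<le> ?h t) at_top"
    using eventually_ge_at_top[of t] by eventually_elim (rule mono)
  ultimately have "pi / 2 / pi + 0 \<le> ?h t"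
    by (rule tendsto_upperbound) simp
  then show ?thesis by simp
qed

lemma sinc_square_primitive_neg: "0 < t \<Longrightarrow> sinc_square_primitive (- t) = - sinc_square_primitive t"
  using Si_neg[of "2 * pi * t"] by (simp add: sinc_square_primitive_nonzero)

lemma norm_fourier_character:
  assumes "w \<noteq> s"
  shows "(cmod (fourier (character s) w))\<^sup>2 = (sin (pi * (w - s)) / (pi * (w - s)))\<^sup>2"
proof -
  have "(cmod (cis (2 * t) - 1))\<^sup>2 = (2 * sin t)\<^sup>2" for t
    unfolding cmod_power2
    by (simp add: cos_double_sin sin_double cos_squared_eq power_mult_distrib)
      (simp add: power4_eq_xxxx power2_eq_square algebra_simps)
  from this[of "pi * (s - w)"]
  have "(cmod (fourier (character s) w))\<^sup>2 = (2 * sin (pi * (s - w)))\<^sup>2 / (2 * pi * (s - w))\<^sup>2"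
    using assms by (simp add: fourier_character norm_divide norm_mult power_divide power_mult_distrib mult.assoc flip: of_real_diff)
  also have "sin (pi * (s - w)) = - sin (pi * (w - s))"
    using sin_minus[of "pi * (w - s)"] by (simp add: algebra_simps)
  also have "(2 * pi * (s - w))\<^sup>2 = (2 * pi * (w - s))\<^sup>2"
    unfolding power_mult_distrib power2_commute[of s w] ..
  finally show ?thesis by (simp add: power_divide power_mult_distrib)
qed

text \<open>The energy of a character is a squared sinc centred at \<open>s\<close>. Oddness of the
  primitive turns the difference of its values at the ends into a sum of two values at positive
  arguments, each at least \<open>1 / 2\<close> minus a tail.\<close>

lemma character_energy_ge:
  assumes "a < s" "s < b"
  shows "1 - (1 / (s - a) + 1 / (b - s)) / pi\<^sup>2 \<le> integral {a..b} (\<lambda>w. (cmod (fourier (character s) w))\<^sup>2)"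
proof -
  let ?P = "\<lambda>w. sinc_square_primitive (w - s)"
  have "((\<lambda>w. (cmod (fourier (character s) w))\<^sup>2) has_integral (?P b - ?P a)) {a..b}"
  \<comment> \<open>The quotient formula for the derivative excludes the centre \<open>s\<close>,
    where continuity of the primitive suffices.\<close>
  proof (rule fundamental_theorem_of_calculus_strong[where S = "{s}"])
    show "continuous_on {a..b} ?P"
      by (intro continuous_on_compose2[OF continuous_on_sinc_square_primitive[of UNIV]] continuous_intros) auto
    fix x assume "x \<in> {a..b} - {s}"
    then have "x \<noteq> s" by auto
    then have "(?P has_real_derivative (sin (pi * (x - s)) / (pi * (x - s)))\<^sup>2 * 1) (at x)"
      by (intro DERIV_chain2[where f = sinc_square_primitive] DERIV_sinc_square_primitive)
        (auto intro!: derivative_eq_intros)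
    then show "(?P has_vector_derivative (cmod (fourier (character s) x))\<^sup>2) (at x)"
      using \<open>x \<noteq> s\<close> by (simp add: norm_fourier_character has_real_derivative_iff_has_vector_derivative)
  qed (use assms in auto)
  then have "integral {a..b} (\<lambda>w. (cmod (fourier (character s) w))\<^sup>2) = ?P b - ?P a"
    by (rule integral_unique)
  moreover have "?P a = - sinc_square_primitive (s - a)"
    using sinc_square_primitive_neg[of "s - a"] assms by simp
  ultimately show ?thesis
    using sinc_square_primitive_ge[of "s - a"] sinc_square_primitive_ge[of "b - s"] assms
    by (simp add: add_divide_distrib mult.commute)
qed

text \<open>
  The energy outside \<open>[a, b]\<close>. By Bessel's inequality it is a positive semidefinite quadratic form, so a
  bound for every single character yields one for trigonometric polynomials without computing
  any cross term.
\<close>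

definition energy_defect :: "real \<Rightarrow> real \<Rightarrow> (real \<Rightarrow> complex) \<Rightarrow> real" where
  "energy_defect a b f = (L2_norm f)\<^sup>2 - integral {a..b} (\<lambda>w. (cmod (fourier f w))\<^sup>2)"

lemma energy_defect_nonneg: "f \<in> L2_unit \<Longrightarrow> 0 \<le> energy_defect a b f"
  using fourier_energy_le[of f a b] by (simp add: energy_defect_def)

lemma energy_defect_cmult: "energy_defect a b (\<lambda>x. c * f x) = (cmod c)\<^sup>2 * energy_defect a b f"
  by (simp add: energy_defect_def L2_norm_sq fourier_cmult norm_mult power_mult_distrib algebra_simps)

text \<open>The weighted parallelogram identity \<open>id\<close> holds pointwise for the functions
  and for their transforms, hence for the defect as well. The subtracted term is a defect and is
  dropped by positivity.\<close>

lemma energy_defect_add_le: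
  assumes f: "f \<in> L2_unit" and g: "g \<in> L2_unit" and t: "0 < t"
  shows "energy_defect a b (\<lambda>x. f x + g x) \<le> (1 + t) * energy_defect a b f + (1 + 1 / t) * energy_defect a b g"
proof -
  define h where "h = (\<lambda>x. f x - of_real (1 / t) * g x)"
  have h: "h \<in> L2_unit" unfolding h_def by (intro L2_unit_diff L2_unit_cmult f g)
  have id: "(cmod (u + v))\<^sup>2 = (1 + t) * (cmod u)\<^sup>2 + (1 + 1 / t) * (cmod v)\<^sup>2
      - t * (cmod (u - of_real (1 / t) * v))\<^sup>2" for u v
    unfolding cmod_power2 using t by (simp add: power2_eq_square field_simps)
  have 1: "(L2_norm (\<lambda>x. f x + g x))\<^sup>2 =
      (1 + t) * (L2_norm f)\<^sup>2 + (1 + 1 / t) * (L2_norm g)\<^sup>2 - t * (L2_norm h)\<^sup>2"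
    unfolding L2_norm_sq id h_def[symmetric]
    using L2_unit_square_integrable[OF f] L2_unit_square_integrable[OF g] L2_unit_square_integrable[OF h]
    unfolding h_def by simp
  let ?E = "\<lambda>f. integral {a..b} (\<lambda>w. (cmod (fourier f w))\<^sup>2)"
  have "?E (\<lambda>x. f x + g x) = integral {a..b} (\<lambda>w. (1 + t) * (cmod (fourier f w))\<^sup>2
      + (1 + 1 / t) * (cmod (fourier g w))\<^sup>2 - t * (cmod (fourier h w))\<^sup>2)"
    unfolding fourier_add[OF f g] id h_def fourier_diff[OF f L2_unit_cmult[OF g]] fourier_cmult ..
  also have "\<dots> = (1 + t) * ?E f + (1 + 1 / t) * ?E g - t * ?E h"
    by (intro integral_unique has_integral_add has_integral_diff has_integral_mult_right
        integrable_integral fourier_square_integrable f g h)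
  finally have "energy_defect a b (\<lambda>x. f x + g x) + t * energy_defect a b h =
      (1 + t) * energy_defect a b f + (1 + 1 / t) * energy_defect a b g"
    unfolding energy_defect_def 1 by (simp add: algebra_simps)
  moreover have "0 \<le> t * energy_defect a b h" using t energy_defect_nonneg[OF h] by simp
  ultimately show ?thesis by simp
qed

text \<open>This is Cauchy-Schwarz for a semidefinite form. In the inductive step
  \<open>t = card S\<close> is the weight for which both coefficients become
  \<open>card S + 1\<close>.\<close>

lemma energy_defect_sum_le:
  assumes "finite S" "\<And>m. m \<in> S \<Longrightarrow> f m \<in> L2_unit"
  shows "energy_defect a b (\<lambda>x. \<Sum>m\<in>S. f m x) \<le> real (card S) * (\<Sum>m\<in>S. energy_defect a b (f m))"
  using assms
proof (induction S rule: finite_induct)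
  case empty
  then show ?case by (simp add: energy_defect_def fourier_zero L2_norm_def)
next
  case (insert k S)
  show ?case
  proof (cases "S = {}")
    case False
    define n where "n = real (card S)"
    have n: "n > 0" using False insert by (simp add: n_def card_gt_0_iff)
    have "energy_defect a b (\<lambda>x. \<Sum>m\<in>insert k S. f m x) =
        energy_defect a b (\<lambda>x. f k x + (\<Sum>m\<in>S. f m x))"
      using insert by simp
    also have "\<dots> \<le> (1 + n) * energy_defect a b (f k) + (1 + 1 / n) * energy_defect a b (\<lambda>x. \<Sum>m\<in>S. f m x)"
      using insert n by (intro energy_defect_add_le L2_unit_sum) auto
    also have "\<dots> \<le> (1 + n) * energy_defect a b (f k) + (1 + 1 / n) * (n * (\<Sum>m\<in>S. energy_defect a b (f m)))"
      using insert n unfolding n_def by (intro add_left_mono mult_left_mono) auto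
    also have "\<dots> = real (card (insert k S)) * (\<Sum>m\<in>insert k S. energy_defect a b (f m))"
      using insert n by (simp add: n_def field_simps)
    finally show ?thesis .
  qed (use insert in simp)
qed

text \<open>Every frequency of the polynomial is at distance at least \<open>r - M\<close> from both
  ends of the band, so each character loses at most \<open>2 / (pi\<^sup>2 * (r - M))\<close>. The
  factor \<open>2 * M + 1\<close> is the number of characters.\<close>

lemma trig_poly_energy_ge:
  fixes c :: "int \<Rightarrow> complex" and M :: nat
  assumes "real M < r" "a \<le> - r" "r \<le> b"
  shows "(1 - 2 * (2 * real M + 1) / (pi\<^sup>2 * (r - real M))) * (\<Sum>m=-int M..int M. (cmod (c m))\<^sup>2)
     \<le> integral {a..b} (\<lambda>w. (cmod (fourier (\<lambda>x. \<Sum>m=-int M..int M. c m * character (of_int m) x) w))\<^sup>2)"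
proof -
  let ?S = "{-int M..int M}"
  let ?d = "2 / (pi\<^sup>2 * (r - real M))"
  have d: "energy_defect a b (character (of_int m)) \<le> ?d" if "m \<in> ?S" for m
  proof -
    have "real_of_int m \<le> real M" "- real M \<le> real_of_int m" using that by auto
    then have 1: "r - real M \<le> of_int m - a" "r - real M \<le> b - of_int m" using assms by auto
    have "energy_defect a b (character (of_int m)) \<le> (1 / (of_int m - a) + 1 / (b - of_int m)) / pi\<^sup>2"
      using character_energy_ge[of a "of_int m" b] 1 assms
      by (simp add: energy_defect_def L2_norm_sq)
    also have "\<dots> \<le> (1 / (r - real M) + 1 / (r - real M)) / pi\<^sup>2"
      using 1 assms by (intro divide_right_mono add_mono divide_left_mono) auto
    also have "\<dots> = ?d" by (simp add: field_simps)
    finally show ?thesis .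
  qed
  have "energy_defect a b (\<lambda>x. \<Sum>m\<in>?S. c m * character (of_int m) x)
      \<le> real (card ?S) * (\<Sum>m\<in>?S. energy_defect a b (\<lambda>x. c m * character (of_int m) x))"
    by (intro energy_defect_sum_le L2_unit_cmult L2_unit_character) auto
  also have "\<dots> \<le> real (card ?S) * (\<Sum>m\<in>?S. (cmod (c m))\<^sup>2 * ?d)"
    unfolding energy_defect_cmult by (intro mult_left_mono sum_mono d) auto
  also have "\<dots> = 2 * (2 * real M + 1) / (pi\<^sup>2 * (r - real M)) * (\<Sum>m\<in>?S. (cmod (c m))\<^sup>2)"
    unfolding sum_distrib_right[symmetric] by (simp add: field_simps)
  finally show ?thesis
    unfolding energy_defect_def by (simp add: L2_norm_char_sum algebra_simps)
qed

section \<open>Sampling\<close>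

lemma L2_norm_bounded_mult:
  assumes f: "f \<in> L2_unit" and b: "b \<in> borel_measurable unit_measure"
    and B: "\<And>x. 0 < x \<Longrightarrow> x < 1 \<Longrightarrow> cmod (b x) \<le> B"
  shows "(L2_norm (\<lambda>x. b x * f x))\<^sup>2 \<le> B\<^sup>2 * (L2_norm f)\<^sup>2"
proof -
  have "(L2_norm (\<lambda>x. b x * f x))\<^sup>2 \<le> (LINT x|unit_measure. B\<^sup>2 * (cmod (f x))\<^sup>2)"
    unfolding L2_norm_sq
  proof (rule Bochner_Integration.integral_mono)
    show "integrable unit_measure (\<lambda>x. (cmod (b x * f x))\<^sup>2)"
      by (rule L2_unit_square_integrable[OF L2_unit_bounded_mult[OF f b B]])
    show "integrable unit_measure (\<lambda>x. B\<^sup>2 * (cmod (f x))\<^sup>2)"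
      using L2_unit_square_integrable[OF f] by simp
    fix x assume "x \<in> space unit_measure"
    then show "(cmod (b x * f x))\<^sup>2 \<le> B\<^sup>2 * (cmod (f x))\<^sup>2"
      using B[of x] by (auto intro!: mult_right_mono power_mono simp: norm_mult power_mult_distrib)
  qed
  then show ?thesis by (simp add: L2_norm_sq)
qed

text \<open>Centring the support at \<open>0\<close> halves the bandwidth, so that differentiation costs only a factor \<open>pi\<close>.\<close>

definition centred_fourier :: "(real \<Rightarrow> complex) \<Rightarrow> real \<Rightarrow> complex" where
  "centred_fourier f w = cis (pi * w) * fourier f w"

lemma norm_centred_fourier [simp]: "cmod (centred_fourier f w) = cmod (fourier f w)"
  by (simp add: centred_fourier_def norm_mult)

text \<open>The kernel of the centred transform is the exponential of
  \<open>\<i> * pi * w * (1 - 2 * x)\<close>. Differentiation in \<open>w\<close> therefore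
  multiplies \<open>f\<close> by \<open>\<i> * pi * (1 - 2 * x)\<close>, of modulus at most
  \<open>pi\<close> on the unit interval.\<close>

lemma centred_fourier_derivative:
  assumes f: "f \<in> L2_unit"
  obtains h where "h \<in> L2_unit" "(L2_norm h)\<^sup>2 \<le> pi\<^sup>2 * (L2_norm f)\<^sup>2"
    "\<And>w. (centred_fourier f has_vector_derivative centred_fourier h w) (at w)"
proof
  let ?b = "\<lambda>x. \<i> * of_real (pi * (1 - 2 * x))"
  let ?h = "\<lambda>x. ?b x * f x"
  have m: "?b \<in> borel_measurable unit_measure"
    by (intro borel_measurable_unit_continuous continuous_intros)
  have B: "cmod (?b x) \<le> pi" if "0 < x" "x < 1" for x
  proof -
    have "\<bar>pi * (1 - 2 * x)\<bar> \<le> pi * 1"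
      unfolding abs_mult using that by (intro mult_mono) auto
    then show ?thesis by (simp only: norm_mult norm_ii norm_of_real)
  qed
  show "?h \<in> L2_unit" by (rule L2_unit_bounded_mult[OF f m B])
  show "(L2_norm ?h)\<^sup>2 \<le> pi\<^sup>2 * (L2_norm f)\<^sup>2" by (rule L2_norm_bounded_mult[OF f m B])
  have m2: "(\<lambda>x. - (2 * pi * \<i> * of_real x)) \<in> borel_measurable unit_measure"
    by (intro borel_measurable_unit_continuous continuous_intros)
  have h2: "(\<lambda>x. - (2 * pi * \<i> * of_real x) * f x) \<in> L2_unit"
    by (rule L2_unit_bounded_mult[OF f m2, where B = "2 * pi"]) (auto simp: norm_mult)
  fix w
  have "fourier ?h w = fourier (\<lambda>x. (\<i> * of_real pi) * f x + - (2 * pi * \<i> * of_real x) * f x) w"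
    by (simp add: algebra_simps)
  also have "\<dots> = (\<i> * of_real pi) * fourier f w + fourier (\<lambda>x. - (2 * pi * \<i> * of_real x) * f x) w"
    by (simp only: fourier_add[OF L2_unit_cmult[OF f] h2] fourier_cmult)
  finally have "centred_fourier ?h w = cis (pi * w) * fourier (\<lambda>x. - (2 * pi * \<i> * of_real x) * f x) w
      + \<i> * of_real pi * cis (pi * w) * fourier f w"
    unfolding centred_fourier_def by (simp only: algebra_simps)
  then show "(centred_fourier f has_vector_derivative centred_fourier ?h w) (at w)"
    using has_vector_derivative_mult[OF has_vector_derivative_cis fourier_has_vector_derivative[OF f]]
    unfolding centred_fourier_def[of f, abs_def] by simp
qed

lemma continuous_on_centred_fourier: "f \<in> L2_unit \<Longrightarrow> continuous_on A (centred_fourier f)"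
  unfolding centred_fourier_def[abs_def] by (intro continuous_intros continuous_on_fourier)

section \<open>Cells around the sampling points\<close>

definition cell_end :: "nat \<Rightarrow> real \<Rightarrow> (nat \<Rightarrow> real) \<Rightarrow> nat \<Rightarrow> real" where
  "cell_end N K w n = (ext_point N K w n + ext_point N K w (n + 1)) / 2"

text \<open>Cell \<open>n\<close> runs from \<open>cell_end\<close> at \<open>n - 1\<close> to
  \<open>cell_end\<close> at \<open>n\<close>. This makes a weighted sum of squared samples the
  energy of a step function.\<close>

lemma weight_eq_cell_length:
  "1 \<le> n \<Longrightarrow> weight N K w n = cell_end N K w n - cell_end N K w (n - 1)"
  by (simp add: weight_def cell_end_def diff_divide_distrib add_divide_distrib)

text \<open>A single sampling set of the sequence. The lower gap bound is weak because the
  wrap-around gaps vanish when \<open>w 1 = - K\<close> and \<open>w N = K\<close>.\<close>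

locale sampling_set =
  fixes N :: nat and K :: real and w :: "nat \<Rightarrow> real" and \<delta> :: real
  assumes N: "1 \<le> N" and \<delta>: "0 < \<delta>"
    and range: "- K \<le> w 1" "w N \<le> K"
    and gap: "\<And>n. n \<le> N \<Longrightarrow> ext_point N K w n \<le> ext_point N K w (n + 1)"
      "\<And>n. n \<le> N \<Longrightarrow> ext_point N K w (n + 1) \<le> ext_point N K w n + \<delta>"
begin

abbreviation "z \<equiv> cell_end N K w"
abbreviation "\<mu> \<equiv> weight N K w"

lemma cell:
  assumes "n \<in> {1..N}"
  shows "z (n - 1) \<le> w n" "w n \<le> z n" "w n - z (n - 1) \<le> \<delta> / 2" "z n - w n \<le> \<delta> / 2"
    "z (n - 1) \<le> z n"
proof -
  have n: "n - 1 + 1 = n" "n \<le> N" "n - 1 \<le> N" "ext_point N K w n = w n"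
    using assms by (auto simp: ext_point_def)
  show "z (n - 1) \<le> w n" "w n \<le> z n" "w n - z (n - 1) \<le> \<delta> / 2" "z n - w n \<le> \<delta> / 2"
    "z (n - 1) \<le> z n"
    using gap[OF n(2)] gap[OF n(3)] unfolding cell_end_def n(1,4) by (simp_all add: field_simps)
qed

lemma weight_nonneg: "n \<in> {1..N} \<Longrightarrow> 0 \<le> \<mu> n"
  using cell(5)[of n] by (simp add: weight_eq_cell_length)

text \<open>A wrap-around gap of at most \<delta> forces \<open>w 1\<close> to within \<delta> of
  \<open>- K\<close> and \<open>w N\<close> to within \<delta> of \<open>K\<close>. The cells hence
  cover the band up to \<open>\<delta> / 2\<close> at each end.\<close>

lemma first_cell_end: "z 0 \<le> - (K - \<delta> / 2)" and last_cell_end: "K - \<delta> / 2 \<le> z N"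
  using gap[of 0] range N by (auto simp: cell_end_def ext_point_def split: if_splits)

lemma sum_integral_cells:
  fixes g :: "real \<Rightarrow> real"
  assumes g: "continuous_on UNIV g"
  shows "(\<Sum>n=1..N. integral {z (n - 1)..z n} g) = integral {z 0..z N} g"
proof -
  have "z 0 \<le> z n \<and> (\<Sum>j=1..n. integral {z (j - 1)..z j} g) = integral {z 0..z n} g" if "n \<le> N" for n
    using that
  proof (induction n)
    case (Suc n)
    then have IH: "z 0 \<le> z n" "(\<Sum>j=1..n. integral {z (j - 1)..z j} g) = integral {z 0..z n} g" by auto
    have le: "z n \<le> z (Suc n)" using cell(5)[of "Suc n"] Suc by simp
    have "g integrable_on {z 0..z (Suc n)}"
      using g by (intro integrable_continuous_real) (rule continuous_on_subset, auto)
    from Henstock_Kurzweil_Integration.integral_combine[OF IH(1) le this] IH le show ?case by simp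
  qed simp
  then show ?thesis by blast
qed

text \<open>Young's inequality with parameter \<open>s\<close>, integrated over one cell, whose
  length is the weight. Keeping \<open>s\<close> common to all cells lets the estimates be summed
  first and optimised afterwards, which recovers Minkowski's inequality for the whole step
  function.\<close>

lemma cell_integral_le:
  fixes g :: "real \<Rightarrow> complex"
  assumes g: "continuous_on UNIV g" and n: "n \<in> {1..N}" and s: "0 < s"
  defines "E \<equiv> integral {z (n - 1)..z n} (\<lambda>x. (cmod (g x - g (w n)))\<^sup>2)"
    and "I \<equiv> integral {z (n - 1)..z n} (\<lambda>x. (cmod (g x))\<^sup>2)"
  shows "\<mu> n * (cmod (g (w n)))\<^sup>2 \<le> (1 + s) * I + (1 + 1 / s) * E"
    and "I \<le> (1 + s) * (\<mu> n * (cmod (g (w n)))\<^sup>2) + (1 + 1 / s) * E"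
proof -
  have split: "(cmod u)\<^sup>2 \<le> (1 + s) * (cmod v)\<^sup>2 + (1 + 1 / s) * (cmod (u - v))\<^sup>2" for u v
  proof -
    have "(cmod u)\<^sup>2 \<le> (cmod v + cmod (u - v))\<^sup>2"
      using norm_triangle_ineq[of v "u - v"] by (intro power_mono) auto
    also have "\<dots> = (1 + s) * (cmod v)\<^sup>2 + (1 + 1 / s) * (cmod (u - v))\<^sup>2 - s * (cmod v - cmod (u - v) / s)\<^sup>2"
      using s by (simp add: power2_eq_square field_simps)
    finally show ?thesis using s by (smt (verit) mult_nonneg_nonneg zero_le_power2)
  qed
  have c: "continuous_on A g" for A using g continuous_on_subset by blast
  have iE: "((\<lambda>x. (cmod (g x - g (w n)))\<^sup>2) has_integral E) {z (n - 1)..z n}"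
    and iI: "((\<lambda>x. (cmod (g x))\<^sup>2) has_integral I) {z (n - 1)..z n}"
    unfolding E_def I_def by (intro integrable_integral integrable_continuous_real continuous_intros c)+
  have iC: "((\<lambda>x. (cmod (g (w n)))\<^sup>2) has_integral \<mu> n * (cmod (g (w n)))\<^sup>2) {z (n - 1)..z n}"
    using has_integral_const_real[of "(cmod (g (w n)))\<^sup>2" "z (n - 1)" "z n"] n cell(5)[OF n]
    by (simp add: weight_eq_cell_length)
  show "\<mu> n * (cmod (g (w n)))\<^sup>2 \<le> (1 + s) * I + (1 + 1 / s) * E"
    by (rule has_integral_le[OF iC has_integral_add[OF has_integral_mult_right[OF iI] has_integral_mult_right[OF iE]]])
      (use split[of "g (w n)"] in \<open>simp add: norm_minus_commute\<close>)
  show "I \<le> (1 + s) * (\<mu> n * (cmod (g (w n)))\<^sup>2) + (1 + 1 / s) * E"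
    by (rule has_integral_le[OF iI has_integral_add[OF has_integral_mult_right[OF iC] has_integral_mult_right[OF iE]]])
      (rule split)
qed

text \<open>Half cells of length at most \<open>\<delta> / 2\<close> contribute
  \<open>\<delta> / pi\<close> through Wirtinger's inequality, and differentiation contributes
  \<open>pi\<close>; the product is \<delta>.\<close>

lemma sampling_error:
  assumes f: "f \<in> L2_unit"
  shows "(\<Sum>n=1..N. integral {z (n - 1)..z n} (\<lambda>x. (cmod (centred_fourier f x - centred_fourier f (w n)))\<^sup>2))
    \<le> \<delta>\<^sup>2 * (L2_norm f)\<^sup>2"
proof -
  obtain h where h: "h \<in> L2_unit" "(L2_norm h)\<^sup>2 \<le> pi\<^sup>2 * (L2_norm f)\<^sup>2"
    "\<And>x. (centred_fourier f has_vector_derivative centred_fourier h x) (at x)"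
    using centred_fourier_derivative[OF f] by blast
  have "(\<Sum>n=1..N. integral {z (n - 1)..z n} (\<lambda>x. (cmod (centred_fourier f x - centred_fourier f (w n)))\<^sup>2))
     \<le> (\<Sum>n=1..N. (2 * (\<delta> / 2) / pi)\<^sup>2 * integral {z (n - 1)..z n} (\<lambda>x. (cmod (centred_fourier h x))\<^sup>2))"
    using \<delta> by (intro sum_mono wirtinger_cell h continuous_on_centred_fourier cell) auto
  also have "\<dots> = (\<delta> / pi)\<^sup>2 * integral {z 0..z N} (\<lambda>x. (cmod (fourier h x))\<^sup>2)"
    by (simp only: sum_distrib_left[symmetric] norm_centred_fourier)
      (subst sum_integral_cells, auto intro!: continuous_intros continuous_on_fourier h)
  also have "\<dots> \<le> (\<delta> / pi)\<^sup>2 * (pi\<^sup>2 * (L2_norm f)\<^sup>2)"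
    using order_trans[OF fourier_energy_le[OF h(1)] h(2)] by (intro mult_left_mono) auto
  also have "\<dots> = \<delta>\<^sup>2 * (L2_norm f)\<^sup>2" by (simp add: power_divide)
  finally show ?thesis .
qed

section \<open>Comparison of the sampled energy with the energy\<close>

definition sampled_energy :: "(real \<Rightarrow> complex) \<Rightarrow> real" where
  "sampled_energy f = (\<Sum>n=1..N. \<mu> n * (cmod (fourier f (w n)))\<^sup>2)"

text \<open>The Young parameter is \<delta>, the ratio of the error bound to the norm, so that the
  two terms add up to the square of \<open>1 + \<delta>\<close>.\<close>

lemma sampled_energy_le:
  assumes f: "f \<in> L2_unit"
  shows "sampled_energy f \<le> (1 + \<delta>)\<^sup>2 * (L2_norm f)\<^sup>2"
proof -
  let ?I = "\<lambda>n. integral {z (n - 1)..z n} (\<lambda>x. (cmod (centred_fourier f x))\<^sup>2)"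
  let ?E = "\<lambda>n. integral {z (n - 1)..z n} (\<lambda>x. (cmod (centred_fourier f x - centred_fourier f (w n)))\<^sup>2)"
  have "sampled_energy f \<le> (\<Sum>n=1..N. (1 + \<delta>) * ?I n + (1 + 1 / \<delta>) * ?E n)"
    unfolding sampled_energy_def
  proof (rule sum_mono)
    fix n assume "n \<in> {1..N}"
    from cell_integral_le(1)[OF continuous_on_centred_fourier[OF f] this \<delta>]
    show "\<mu> n * (cmod (fourier f (w n)))\<^sup>2 \<le> (1 + \<delta>) * ?I n + (1 + 1 / \<delta>) * ?E n"
      by simp
  qed
  also have "\<dots> = (1 + \<delta>) * (\<Sum>n=1..N. ?I n) + (1 + 1 / \<delta>) * (\<Sum>n=1..N. ?E n)"
    by (simp only: sum.distrib sum_distrib_left)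
  also have "(\<Sum>n=1..N. ?I n) = integral {z 0..z N} (\<lambda>x. (cmod (fourier f x))\<^sup>2)"
    by (subst sum_integral_cells) (auto intro!: continuous_intros continuous_on_fourier f)
  also have "(1 + \<delta>) * \<dots> + (1 + 1 / \<delta>) * (\<Sum>n=1..N. ?E n)
      \<le> (1 + \<delta>) * (L2_norm f)\<^sup>2 + (1 + 1 / \<delta>) * (\<delta>\<^sup>2 * (L2_norm f)\<^sup>2)"
    using \<delta> by (intro add_mono mult_left_mono fourier_energy_le sampling_error f) auto
  also have "\<dots> = (1 + \<delta>)\<^sup>2 * (L2_norm f)\<^sup>2"
    using \<delta> by (simp add: power2_eq_square field_simps)
  finally show ?thesis .
qed

lemma energy_le_sampled_energy:
  assumes f: "f \<in> L2_unit" and s: "0 < s"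
  shows "integral {z 0..z N} (\<lambda>x. (cmod (fourier f x))\<^sup>2)
    \<le> (1 + s) * sampled_energy f + (1 + 1 / s) * (\<delta>\<^sup>2 * (L2_norm f)\<^sup>2)"
proof -
  let ?I = "\<lambda>n. integral {z (n - 1)..z n} (\<lambda>x. (cmod (centred_fourier f x))\<^sup>2)"
  let ?E = "\<lambda>n. integral {z (n - 1)..z n} (\<lambda>x. (cmod (centred_fourier f x - centred_fourier f (w n)))\<^sup>2)"
  have "integral {z 0..z N} (\<lambda>x. (cmod (fourier f x))\<^sup>2) = (\<Sum>n=1..N. ?I n)"
    by (subst sum_integral_cells) (auto intro!: continuous_intros continuous_on_fourier f)
  also have "\<dots> \<le> (\<Sum>n=1..N. (1 + s) * (\<mu> n * (cmod (fourier f (w n)))\<^sup>2) + (1 + 1 / s) * ?E n)"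
  proof (rule sum_mono)
    fix n assume "n \<in> {1..N}"
    from cell_integral_le(2)[OF continuous_on_centred_fourier[OF f] this s]
    show "?I n \<le> (1 + s) * (\<mu> n * (cmod (fourier f (w n)))\<^sup>2) + (1 + 1 / s) * ?E n"
      by simp
  qed
  also have "\<dots> = (1 + s) * sampled_energy f + (1 + 1 / s) * (\<Sum>n=1..N. ?E n)"
    by (simp only: sum.distrib sum_distrib_left sampled_energy_def)
  also have "\<dots> \<le> (1 + s) * sampled_energy f + (1 + 1 / s) * (\<delta>\<^sup>2 * (L2_norm f)\<^sup>2)"
    using s by (intro add_left_mono mult_left_mono sampling_error f) auto
  finally show ?thesis .
qed

end

section \<open>Least squares\<close>

text \<open>Gram-Schmidt by induction on \<open>S\<close>. The induction hypothesis is applied to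
  \<open>u\<close> and to the new vector \<open>v k\<close>, giving residuals \<open>r\<close> and
  \<open>e\<close>; then \<open>r\<close> is projected along \<open>e\<close>. Linear independence
  is replaced by the case distinction on \<open>B e e\<close>.\<close>

lemma weighted_normal_equations:
  fixes \<mu> :: "'n \<Rightarrow> real" and v :: "'i \<Rightarrow> 'n \<Rightarrow> complex"
  assumes A: "finite A" and \<mu>: "\<And>n. n \<in> A \<Longrightarrow> 0 \<le> \<mu> n" and S: "finite S"
  shows "\<exists>a. \<forall>k\<in>S. (\<Sum>n\<in>A. of_real (\<mu> n) * (u n - (\<Sum>j\<in>S. a j * v j n)) * cnj (v k n)) = 0"
  using S
proof (induction S arbitrary: u rule: finite_induct)
  case empty
  then show ?case by simp
next
  case (insert k S)
  define B where "B x y = (\<Sum>n\<in>A. of_real (\<mu> n) * x n * cnj (y n))" for x y :: "'n \<Rightarrow> complex"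
  have B_diff: "B (\<lambda>n. x n - t * y n) g = B x g - t * B y g" for x y g t
    by (simp add: B_def sum_distrib_left sum_subtractf[symmetric] algebra_simps)
  have B_diff_sum: "B x (\<lambda>n. g n - (\<Sum>j\<in>S. b j * v j n)) = B x g - (\<Sum>j\<in>S. cnj (b j) * B x (v j))" for x g b
    unfolding B_def sum_distrib_left sum.swap[of _ A S]
    by (simp add: sum_distrib_left sum_subtractf right_diff_distrib mult_ac)
  obtain a where a: "B (\<lambda>n. u n - (\<Sum>j\<in>S. a j * v j n)) (v j) = 0" if "j \<in> S" for j
    using insert.IH[of u] unfolding B_def by blast
  obtain b where b: "B (\<lambda>n. v k n - (\<Sum>j\<in>S. b j * v j n)) (v j) = 0" if "j \<in> S" for j
    using insert.IH[of "v k"] unfolding B_def by blast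
  define r where "r n = u n - (\<Sum>j\<in>S. a j * v j n)" for n
  define e where "e n = v k n - (\<Sum>j\<in>S. b j * v j n)" for n
  define t where "t = B r e / B e e"
  define a' where "a' j = (if j = k then t else a j - t * b j)" for j
  have r': "(\<lambda>n. u n - (\<Sum>j\<in>insert k S. a' j * v j n)) = (\<lambda>n. r n - t * e n)"
  proof
    fix n
    have "(\<Sum>j\<in>S. a' j * v j n) = (\<Sum>j\<in>S. a j * v j n) - t * (\<Sum>j\<in>S. b j * v j n)"
      unfolding sum_distrib_left sum_subtractf[symmetric]
      using insert.hyps by (intro sum.cong) (auto simp: a'_def algebra_simps)
    moreover have "a' k = t" by (simp add: a'_def)
    ultimately show "u n - (\<Sum>j\<in>insert k S. a' j * v j n) = r n - t * e n"
      using insert.hyps by (simp add: r_def e_def algebra_simps)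
  qed
  have orth: "B (\<lambda>n. r n - t * e n) (v j) = 0" if "j \<in> S" for j
    using a[OF that] b[OF that] by (simp add: B_diff r_def[abs_def] e_def[abs_def])
  \<comment> \<open>In the degenerate case \<open>t\<close> is a division by zero, but then
    \<open>e\<close> vanishes wherever the weight is positive, so \<open>r\<close> is already
    orthogonal to it.\<close>
  have "B r e = 0" if "B e e = 0"
  proof -
    have "B e e = of_real (\<Sum>n\<in>A. \<mu> n * (cmod (e n))\<^sup>2)"
      unfolding B_def mult.assoc of_real_sum of_real_mult complex_norm_square ..
    with that have "(\<Sum>n\<in>A. \<mu> n * (cmod (e n))\<^sup>2) = 0" by (simp only: of_real_eq_0_iff)
    then have "\<mu> n * (cmod (e n))\<^sup>2 = 0" if "n \<in> A" for n
      using sum_nonneg_eq_0_iff[OF A, of "\<lambda>n. \<mu> n * (cmod (e n))\<^sup>2"] \<mu> that by simp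
    then show ?thesis unfolding B_def by (intro sum.neutral) auto
  qed
  then have "B (\<lambda>n. r n - t * e n) e = 0"
    unfolding B_diff t_def by (cases "B e e = 0") simp_all
  then have "B (\<lambda>n. r n - t * e n) (v k) = 0"
    unfolding e_def[abs_def] B_diff_sum using orth by (simp add: e_def[abs_def])
  with orth have "\<forall>j\<in>insert k S. B (\<lambda>n. u n - (\<Sum>j\<in>insert k S. a' j * v j n)) (v j) = 0"
    unfolding r' by blast
  then show ?case unfolding B_def by blast
qed

section \<open>Trigonometric polynomials through their coefficients\<close>

definition trig_sum :: "nat \<Rightarrow> (int \<Rightarrow> complex) \<Rightarrow> real \<Rightarrow> complex" where
  "trig_sum M c x = (\<Sum>m=- int M..int M. c m * character (of_int m) x)"

lemma trig_poly_eq_range: "trig_poly M = range (trig_sum M)"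
  unfolding trig_poly_alt by (auto simp: trig_sum_def[abs_def])

lemma L2_unit_trig_sum [simp]: "trig_sum M c \<in> L2_unit"
  unfolding trig_sum_def[abs_def] by (intro L2_unit_sum L2_unit_cmult L2_unit_character)

lemma L2_norm_trig_sum: "(L2_norm (trig_sum M c))\<^sup>2 = (\<Sum>m=- int M..int M. (cmod (c m))\<^sup>2)"
  unfolding trig_sum_def[abs_def] by (rule L2_norm_char_sum) simp

lemma fourier_trig_sum:
  "fourier (trig_sum M c) y = (\<Sum>m=- int M..int M. c m * fourier (character (of_int m)) y)"
  unfolding trig_sum_def[abs_def] by (simp add: fourier_sum L2_unit_cmult fourier_cmult)

lemma trig_sum_diff: "trig_sum M (\<lambda>m. a m - c m) x = trig_sum M a x - trig_sum M c x"
  by (simp add: trig_sum_def sum_subtractf left_diff_distrib)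

lemma L2_norm_diff_trig_sum:
  assumes "f \<in> L2_unit"
  shows "(L2_norm (\<lambda>x. f x - trig_sum M c x))\<^sup>2 =
      (L2_norm f)\<^sup>2 - (\<Sum>m=- int M..int M. (cmod (fourier f (of_int m)))\<^sup>2)
        + (\<Sum>m=- int M..int M. (cmod (c m - fourier f (of_int m)))\<^sup>2)"
  using L2_norm_diff_char_sum[OF assms, of "{- int M..int M}" c 0] by (simp add: trig_sum_def)

section \<open>From a lower sampling bound to stability and quasi-optimality\<close>

context sampling_set
begin

text \<open>\<open>lower\<close> makes the sampled energy definite on \<open>trig_poly M\<close>
  and, with \<open>sampled_energy_le\<close>, bounds the reconstruction by the ratio
  \<open>C\<close> of the two constants. The bound \<open>\<alpha> \<le> 1\<close> gives
  \<open>C > 1\<close>, which the choice of \<open>t\<close> below requires.\<close>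

lemma stable_quasi_optimal_trig_poly:
  assumes \<alpha>: "0 < \<alpha>" "\<alpha> \<le> 1"
    and lower: "\<And>c. \<alpha>\<^sup>2 * (L2_norm (trig_sum M c))\<^sup>2 \<le> sampled_energy (trig_sum M c)"
  shows "stable_quasi_optimal N K w (trig_poly M) ((1 + \<delta>) / \<alpha>)"
  unfolding stable_quasi_optimal_def
proof
  fix f assume f: "f \<in> L2_unit"
  let ?S = "{- int M..int M}"
  define C where "C = (1 + \<delta>) / \<alpha>"
  have C: "1 < C" using \<alpha> \<delta> by (simp add: C_def)
  obtain a where a: "\<And>k. k \<in> ?S \<Longrightarrow> (\<Sum>n=1..N. of_real (\<mu> n) *
      (fourier f (w n) - (\<Sum>j\<in>?S. a j * fourier (character (of_int j)) (w n)))
      * cnj (fourier (character (of_int k)) (w n))) = 0"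
    using weighted_normal_equations[of "{1..N}" \<mu> ?S "\<lambda>n. fourier f (w n)"
        "\<lambda>m n. fourier (character (of_int m)) (w n)", OF finite_atLeastAtMost weight_nonneg]
    by blast
  define g where "g = trig_sum M a"
  define r where "r = (\<lambda>x. f x - g x)"
  have g: "g \<in> L2_unit" by (simp add: g_def)
  have r: "r \<in> L2_unit" unfolding r_def by (rule L2_unit_diff[OF f g])
  have orth: "(\<Sum>n=1..N. of_real (\<mu> n) * fourier r (w n) * cnj (fourier (trig_sum M c) (w n))) = 0" for c
  proof -
    have "(\<Sum>n=1..N. of_real (\<mu> n) * fourier r (w n) * cnj (fourier (trig_sum M c) (w n))) =
        (\<Sum>m\<in>?S. cnj (c m) * (\<Sum>n=1..N. of_real (\<mu> n) * fourier r (w n) * cnj (fourier (character (of_int m)) (w n))))"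
      unfolding fourier_trig_sum cnj_sum sum_distrib_left
      by (subst sum.swap) (simp add: mult_ac)
    also have "\<dots> = 0"
      unfolding r_def fourier_diff[OF f g] unfolding g_def fourier_trig_sum
      by (intro sum.neutral ballI) (simp only: a mult_zero_right)
    finally show ?thesis .
  qed
  have pythagoras: "sampled_energy (\<lambda>x. f x - trig_sum M c x) =
      sampled_energy r + sampled_energy (trig_sum M (\<lambda>m. a m - c m))" for c
  proof -
    let ?d = "trig_sum M (\<lambda>m. a m - c m)"
    have "fourier (\<lambda>x. f x - trig_sum M c x) y = fourier (\<lambda>x. r x + ?d x) y" for y
      by (simp add: r_def g_def trig_sum_diff)
    then have eq: "fourier (\<lambda>x. f x - trig_sum M c x) y = fourier r y + fourier ?d y" for y
      by (simp add: fourier_add r)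
    have "(cmod (p + q))\<^sup>2 = (cmod p)\<^sup>2 + (cmod q)\<^sup>2 + 2 * Re (p * cnj q)" for p q
      unfolding cmod_power2 by (simp add: power2_eq_square algebra_simps)
    then have "sampled_energy (\<lambda>x. f x - trig_sum M c x) = sampled_energy r + sampled_energy ?d
        + 2 * Re (\<Sum>n=1..N. of_real (\<mu> n) * fourier r (w n) * cnj (fourier ?d (w n)))"
      unfolding sampled_energy_def eq
      by (simp add: sum.distrib sum_distrib_left distrib_left mult_ac)
    then show ?thesis unfolding orth by simp
  qed
  have functional: "wls_functional N K w f (trig_sum M c) =
      sampled_energy r + sampled_energy (trig_sum M (\<lambda>m. a m - c m))" for c
    unfolding pythagoras[symmetric] by (simp add: wls_functional_def sampled_energy_def fourier_diff f)
  have se_nonneg: "0 \<le> sampled_energy h" for h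
    unfolding sampled_energy_def by (intro sum_nonneg mult_nonneg_nonneg weight_nonneg) auto
  have se_zero: "sampled_energy (trig_sum M (\<lambda>m. 0)) = 0"
    by (simp add: sampled_energy_def fourier_trig_sum)
  have min: "wls_reconstruction N K w (trig_poly M) f g"
    unfolding wls_reconstruction_def is_arg_min_def trig_poly_eq_range g_def
    using se_nonneg by (auto simp: functional se_zero not_less)
  have unique: "h = g" if "wls_reconstruction N K w (trig_poly M) f h" for h
  proof -
    from that obtain c where c: "h = trig_sum M c" and
      le: "wls_functional N K w f h \<le> wls_functional N K w f g"
      unfolding wls_reconstruction_def is_arg_min_def trig_poly_eq_range g_def
      by (auto simp: not_less)
    then have "sampled_energy (trig_sum M (\<lambda>m. a m - c m)) \<le> 0"
      unfolding c g_def functional by (simp add: se_zero)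
    with lower[of "\<lambda>m. a m - c m"] have "\<alpha>\<^sup>2 * (\<Sum>m\<in>?S. (cmod (a m - c m))\<^sup>2) \<le> 0"
      by (simp add: L2_norm_trig_sum)
    then have "(\<Sum>m\<in>?S. (cmod (a m - c m))\<^sup>2) \<le> 0"
      using \<alpha> by (simp add: mult_le_0_iff)
    then have "(\<Sum>m\<in>?S. (cmod (a m - c m))\<^sup>2) = 0"
      by (intro antisym sum_nonneg) auto
    then have "\<forall>m\<in>?S. a m = c m"
      by (subst (asm) sum_nonneg_eq_0_iff) auto
    then show "h = g" unfolding c g_def trig_sum_def[abs_def] by (intro ext sum.cong) auto
  qed
  have stable: "L2_norm g \<le> C * L2_norm f"
  proof (rule power2_le_imp_le)
    have "\<alpha>\<^sup>2 * (L2_norm g)\<^sup>2 \<le> sampled_energy g" unfolding g_def by (rule lower)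
    also have "\<dots> \<le> sampled_energy f"
      using pythagoras[of "\<lambda>m. 0"] se_nonneg[of r] by (simp add: trig_sum_def g_def)
    also have "\<dots> \<le> (1 + \<delta>)\<^sup>2 * (L2_norm f)\<^sup>2" by (rule sampled_energy_le[OF f])
    finally show "(L2_norm g)\<^sup>2 \<le> (C * L2_norm f)\<^sup>2"
      using \<alpha> by (simp add: C_def power_mult_distrib power_divide pos_le_divide_eq mult.commute)
    show "0 \<le> C * L2_norm f" using C by simp
  qed
  \<comment> \<open>\<open>p\<close> is the squared distance from the reconstruction to the best
    approximation of \<open>f\<close>, and \<open>q\<close> is the squared distance from
    \<open>f\<close> to that best approximation.\<close>
  define p where "p = (\<Sum>m\<in>?S. (cmod (a m - fourier f (of_int m)))\<^sup>2)"
  define q where "q = (L2_norm f)\<^sup>2 - (\<Sum>m\<in>?S. (cmod (fourier f (of_int m)))\<^sup>2)"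
  have best: "q \<le> (L2_norm (\<lambda>x. f x - trig_sum M c x))\<^sup>2" for c
    unfolding L2_norm_diff_trig_sum[OF f] q_def by (simp add: sum_nonneg)
  have rq: "(L2_norm r)\<^sup>2 = q + p"
    unfolding r_def g_def L2_norm_diff_trig_sum[OF f] q_def p_def by simp
  \<comment> \<open>The norm bound of the reconstruction, applied to the residual of the best approximation
    displaced by \<open>t\<close> times its own reconstruction. The choice \<open>t = 1 / (C\<^sup>2 - 1)\<close> below is optimal.\<close>
  have key: "(1 + t)\<^sup>2 * p \<le> C\<^sup>2 * (q + t\<^sup>2 * p)" for t
  proof -
    let ?c = "\<lambda>m. fourier f (of_int m) - of_real t * (a m - fourier f (of_int m))"
    have "(\<lambda>m. a m - ?c m) = (\<lambda>m. of_real (1 + t) * (a m - fourier f (of_int m)))"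
      by (simp add: algebra_simps)
    then have "(L2_norm (trig_sum M (\<lambda>m. a m - ?c m)))\<^sup>2 = (1 + t)\<^sup>2 * p"
      by (simp only: L2_norm_trig_sum p_def norm_mult norm_of_real power_mult_distrib power2_abs
          sum_distrib_left)
    then have "\<alpha>\<^sup>2 * ((1 + t)\<^sup>2 * p) \<le> sampled_energy (trig_sum M (\<lambda>m. a m - ?c m))"
      using lower[of "\<lambda>m. a m - ?c m"] by simp
    also have "\<dots> \<le> sampled_energy (\<lambda>x. f x - trig_sum M ?c x)"
      using pythagoras[of ?c] se_nonneg[of r] by simp
    also have "\<dots> \<le> (1 + \<delta>)\<^sup>2 * (L2_norm (\<lambda>x. f x - trig_sum M ?c x))\<^sup>2"
      by (intro sampled_energy_le L2_unit_diff f L2_unit_trig_sum)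
    also have "(L2_norm (\<lambda>x. f x - trig_sum M ?c x))\<^sup>2 = q + t\<^sup>2 * p"
      unfolding L2_norm_diff_trig_sum[OF f] q_def p_def
      by (simp add: norm_mult power_mult_distrib sum_distrib_left)
    finally show ?thesis
      using \<alpha> by (simp add: C_def power_divide field_simps)
  qed
  have "q + p \<le> C\<^sup>2 * q"
  proof -
    \<comment> \<open>With \<open>t = 1 / D\<close>, multiplying \<open>key\<close> by
      \<open>D\<^sup>2\<close> and cancelling \<open>D + 1\<close> leaves
      \<open>(D + 1) * p \<le> D\<^sup>2 * q + p\<close>, that is
      \<open>p \<le> D * q\<close>.\<close>
    define D where "D = C\<^sup>2 - 1"
    have D: "D > 0" using C by (simp add: D_def)
    have "(1 + 1 / D)\<^sup>2 * p \<le> (D + 1) * (q + (1 / D)\<^sup>2 * p)"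
      using key[of "1 / D"] by (simp add: D_def)
    then have "D\<^sup>2 * ((1 + 1 / D)\<^sup>2 * p) \<le> D\<^sup>2 * ((D + 1) * (q + (1 / D)\<^sup>2 * p))"
      by (intro mult_left_mono) auto
    moreover have "D * (1 + 1 / D) = D + 1" "D * (1 / D) = 1"
      using D by (simp_all add: distrib_left)
    then have "D\<^sup>2 * (1 + 1 / D)\<^sup>2 = (D + 1)\<^sup>2" "D\<^sup>2 * (1 / D)\<^sup>2 = 1"
      unfolding power_mult_distrib[symmetric] by simp_all
    then have "D\<^sup>2 * ((1 + 1 / D)\<^sup>2 * p) = (D + 1) * ((D + 1) * p)"
      "D\<^sup>2 * ((D + 1) * (q + (1 / D)\<^sup>2 * p)) = (D + 1) * (D\<^sup>2 * q + p)"
      by algebra+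
    ultimately have "(D + 1) * ((D + 1) * p) \<le> (D + 1) * (D\<^sup>2 * q + p)" by simp
    then have "(D + 1) * p \<le> D\<^sup>2 * q + p" using D by simp
    then have "D * p \<le> D * (D * q)" by (simp add: power2_eq_square algebra_simps)
    then have "p \<le> D * q" using D by simp
    then show ?thesis by (simp add: D_def algebra_simps)
  qed
  have quasi: "L2_norm r \<le> C * L2_norm (\<lambda>x. f x - h x)" if h: "h \<in> trig_poly M" for h
  proof (rule power2_le_imp_le)
    obtain c where c: "h = trig_sum M c" using h by (auto simp: trig_poly_eq_range)
    have "(L2_norm r)\<^sup>2 \<le> C\<^sup>2 * q" using \<open>q + p \<le> C\<^sup>2 * q\<close> by (simp add: rq)
    also have "\<dots> \<le> C\<^sup>2 * (L2_norm (\<lambda>x. f x - h x))\<^sup>2"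
      unfolding c by (intro mult_left_mono best) auto
    finally show "(L2_norm r)\<^sup>2 \<le> (C * L2_norm (\<lambda>x. f x - h x))\<^sup>2" by (simp add: power_mult_distrib)
    show "0 \<le> C * L2_norm (\<lambda>x. f x - h x)" using C by simp
  qed
  have "L2_norm r / C \<le> (INF h\<in>trig_poly M. L2_norm (\<lambda>x. f x - h x))"
    using quasi C by (intro cINF_greatest) (auto simp: trig_poly_eq_range field_simps)
  then have "L2_norm r \<le> C * (INF h\<in>trig_poly M. L2_norm (\<lambda>x. f x - h x))"
    using C by (simp add: field_simps)
  then show "(\<exists>g. wls_reconstruction N K w (trig_poly M) f g) \<and>
      (\<forall>g h. wls_reconstruction N K w (trig_poly M) f g \<longrightarrow> wls_reconstruction N K w (trig_poly M) f h \<longrightarrow>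
        (AE x in unit_measure. g x = h x)) \<and>
      (\<forall>g. wls_reconstruction N K w (trig_poly M) f g \<longrightarrow>
        L2_norm (\<lambda>x. f x - g x) \<le> (1 + \<delta>) / \<alpha> * (INF h\<in>trig_poly M. L2_norm (\<lambda>x. f x - h x)) \<and>
        L2_norm g \<le> (1 + \<delta>) / \<alpha> * L2_norm f)"
    using min unique stable unfolding r_def C_def by blast
qed

text \<open>The factor \<open>3 / 2 + 1 / \<epsilon>\<close> is made of 1 for the frequencies up to
  \<open>M\<close>, \<open>1 / 2\<close> to absorb \<open>\<delta> / 2\<close> by
  \<open>M \<ge> 1\<close>, and \<open>1 / \<epsilon>\<close> for the margin that keeps the leaked
  energy below a fraction \<epsilon>.\<close>

lemma sampled_energy_ge:
  assumes \<epsilon>: "0 < \<epsilon>" "\<epsilon> < 1 - \<delta>" and M: "1 \<le> M" "real M * (3 / 2 + 1 / \<epsilon>) \<le> K"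
  shows "(1 - \<epsilon> - \<delta>)\<^sup>2 * (L2_norm (trig_sum M c))\<^sup>2 \<le> sampled_energy (trig_sum M c)"
proof -
  define P where "P = (L2_norm (trig_sum M c))\<^sup>2"
  define r where "r = K - \<delta> / 2"
  let ?E = "integral {z 0..z N} (\<lambda>x. (cmod (fourier (trig_sum M c) x))\<^sup>2)"
  have P: "0 \<le> P" by (simp add: P_def)
  have r: "real M / \<epsilon> \<le> r - real M"
  proof -
    have "real M * (3 / 2 + 1 / \<epsilon>) = real M + real M / 2 + real M / \<epsilon>" by (simp add: field_simps)
    then show ?thesis using M \<epsilon> \<delta> unfolding r_def by linarith
  qed
  have Mr: "0 < r - real M"
    using M \<epsilon> by (intro less_le_trans[OF _ r] divide_pos_pos) auto
  \<comment> \<open>The numerator uses \<open>M \<ge> 1\<close>; the denominator uses the crude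
    bound 6 for \<open>pi\<^sup>2\<close>.\<close>
  have "2 * (2 * real M + 1) / (pi\<^sup>2 * (r - real M)) \<le> 6 * real M / (6 * (real M / \<epsilon>))"
  proof (rule frac_le)
    have "6 \<le> pi\<^sup>2" using power_mono[of 3 pi 2] pi_gt3 by simp
    then show "6 * (real M / \<epsilon>) \<le> pi\<^sup>2 * (r - real M)"
      using r M \<epsilon> by (intro mult_mono) auto
  qed (use M \<epsilon> in auto)
  also have "\<dots> = \<epsilon>" using M \<epsilon> by simp
  finally have tail: "1 - \<epsilon> \<le> 1 - 2 * (2 * real M + 1) / (pi\<^sup>2 * (r - real M))" by simp
  \<comment> \<open>Passing to the square gives the lower bound \<open>1 - \<epsilon>\<close> at the
    level of norms, from which the sampling error \<delta> can be subtracted.\<close>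
  have "(1 - \<epsilon>)\<^sup>2 * P \<le> (1 - \<epsilon>) * P"
    using \<epsilon> \<delta> P by (intro mult_right_mono) (auto simp: power2_eq_square mult_left_le)
  also have "\<dots> \<le> (1 - 2 * (2 * real M + 1) / (pi\<^sup>2 * (r - real M))) * P"
    by (rule mult_right_mono[OF tail P])
  also have "\<dots> \<le> ?E"
    unfolding P_def L2_norm_trig_sum unfolding trig_sum_def[abs_def]
    using Mr first_cell_end last_cell_end by (intro trig_poly_energy_ge) (auto simp: r_def)
  \<comment> \<open>The optimal Young parameter: the ratio of the error bound \<delta> to the
    expected sampled norm \<open>1 - \<epsilon> - \<delta>\<close>.\<close>
  also have "\<dots> \<le> (1 + \<delta> / (1 - \<epsilon> - \<delta>)) * sampled_energy (trig_sum M c)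
      + (1 + 1 / (\<delta> / (1 - \<epsilon> - \<delta>))) * (\<delta>\<^sup>2 * P)"
    unfolding P_def using \<delta> \<epsilon> by (intro energy_le_sampled_energy) auto
  also have "1 + \<delta> / (1 - \<epsilon> - \<delta>) = (1 - \<epsilon>) / (1 - \<epsilon> - \<delta>)"
    using \<epsilon> by (simp add: field_simps)
  also have "(1 + 1 / (\<delta> / (1 - \<epsilon> - \<delta>))) * (\<delta>\<^sup>2 * P) = (1 - \<epsilon>) * \<delta> * P"
    using \<delta> by (simp add: power2_eq_square field_simps)
  finally have "(1 - \<epsilon>) * ((1 - \<epsilon> - \<delta>) * P) \<le> (1 - \<epsilon>) * (sampled_energy (trig_sum M c) / (1 - \<epsilon> - \<delta>))"
    by (simp add: power2_eq_square algebra_simps)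
  then have "(1 - \<epsilon> - \<delta>) * P \<le> sampled_energy (trig_sum M c) / (1 - \<epsilon> - \<delta>)"
    by (rule mult_left_le_imp_le) (use \<epsilon> \<delta> in simp)
  then show ?thesis
    using \<epsilon> unfolding P_def[symmetric] by (simp add: power2_eq_square field_simps)
qed

end

lemma sampling_set_of_uniformly_dense:
  assumes u: "uniformly_dense \<delta> \<Omega> K" and N: "1 \<le> N"
  shows "sampling_set N (K N) (\<Omega> N) \<delta>"
proof
  let ?e = "ext_point N (K N) (\<Omega> N)"
  have mono: "strict_mono_on {1..N} (\<Omega> N)" and range: "\<Omega> N ` {1..N} \<subseteq> {- K N..K N}"
    and gap: "(MAX n\<in>{0..N}. ?e (n + 1) - ?e n) \<le> \<delta>"
    using u N by (auto simp: uniformly_dense_def)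
  show "1 \<le> N" by (rule N)
  show "0 < \<delta>" using u by (simp add: uniformly_dense_def)
  show w: "- K N \<le> \<Omega> N 1" "\<Omega> N N \<le> K N" using range N by (auto simp: image_subset_iff)
  fix n assume n: "n \<le> N"
  have "?e (n + 1) - ?e n \<le> (MAX n\<in>{0..N}. ?e (n + 1) - ?e n)"
    using n by (intro Max_ge) auto
  then show "?e (n + 1) \<le> ?e n + \<delta>" using gap by linarith
  show "?e n \<le> ?e (n + 1)"
  \<comment> \<open>These are the two wrap-around gaps, where the order follows from the containment
    of the points in the band and not from their monotonicity.\<close>
  proof (cases "n = 0 \<or> n = N")
    case True
    then show ?thesis using w N by (auto simp: ext_point_def)
  next
    case False
    then have "\<Omega> N n < \<Omega> N (n + 1)" using n by (intro strict_mono_onD[OF mono]) auto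
    then show ?thesis using False n by (simp add: ext_point_def)
  qed
qed

theorem mainTheorem3:
  fixes \<delta> \<epsilon> :: real
  assumes "0 < \<delta>" and "\<delta> < 1" and "0 < \<epsilon>" and "\<epsilon> < 1 - \<delta>"
  shows "\<exists>c>0. \<forall>(\<Omega> :: nat \<Rightarrow> nat \<Rightarrow> real) (K :: nat \<Rightarrow> real).
           uniformly_dense \<delta> \<Omega> K \<longrightarrow>
           (\<forall>M\<ge>1. \<forall>N\<ge>1. real M \<le> c * K N \<longrightarrow>
              stable_quasi_optimal N (K N) (\<Omega> N) (trig_poly M) ((1 + \<delta>) / (1 - \<epsilon> - \<delta>)))"
proof (intro exI conjI allI impI)
  \<comment> \<open>The witness is \<open>1 / ?d\<close>, which turns the condition on
    \<open>M\<close> into the bandwidth hypothesis of \<open>sampled_energy_ge\<close>.\<close>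
  let ?d = "3 / 2 + 1 / \<epsilon>"
  have d: "0 < ?d" using assms by (simp add: add_pos_pos)
  then show "0 < 1 / ?d" by simp
  fix \<Omega> K M N
  assume u: "uniformly_dense \<delta> \<Omega> K" and M: "1 \<le> M" and N: "1 \<le> N"
    and le: "real M \<le> 1 / ?d * K N"
  interpret sampling_set N "K N" "\<Omega> N" \<delta>
    by (rule sampling_set_of_uniformly_dense[OF u N])
  have "real M * ?d \<le> K N" using le d by (simp add: pos_le_divide_eq)
  then show "stable_quasi_optimal N (K N) (\<Omega> N) (trig_poly M) ((1 + \<delta>) / (1 - \<epsilon> - \<delta>))"
    using assms M by (intro stable_quasi_optimal_trig_poly sampled_energy_ge) auto
qed

end
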